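(* Consider the AD model on the infinite rooted binary tree $\mathcal{T}$ with parameter $p\in[0,1)$, generator $\mathcal{L}$ and reversible Bernoulli($p$) product measure $\mu$. Let $\eta\in\{0,1\}^{\mathcal{T}}$ be a configuration such that $|\mathcal{C}_x(\eta)|<\infty$ for all $x\in\mathcal{T}$, and assume that $\mathrm{gap}(\mathcal{L})>0$. Then there exists $m>0$ and, for any local function $f$, there exist $C_f<\infty$ and $t_0(\eta,f)$ such that for any $t>t_0(\eta,f)$ $$\bigl|\mathbb{E}\bigl(f(\eta_t)\bigr)-\mu(f)\bigr|\le C_f\,e^{-mt}.$$
   Context: Let $\mathcal{T}$ be the infinite rooted binary tree (each vertex has two children), with root $0$; let $\Omega=\{0,1\}^{\mathcal{T}}$ and let $\mu=\bigotimes_{x\in\mathcal{T}}\mu_x$ be the product measure with each $\mu_x$ Bernoulli($p$) on $\{0,1\}$ (value $1$, "occupied", with probability $p$). A function $f:\Omega\to\mathbb{R}$ is local if it depends on finitely many variables. The AD model is the Markov process on $\Omega$ whose generator acts on local functions by $$\mathcal{L}f(\omega)=\sum_{x\in\mathcal{T}}c_x(\omega)\,[\mu_x(f)-f(\omega)],$$ where $\mu_x(f)=\int d\mu_x(\omega_x)f(\omega)$ averages over $\omega_x$ only, all other variables being held fixed, and $c_x(\omega)=1$ if $\omega$ is $0$ at both children of $x$, $c_x(\omega)=0$ otherwise. The operator $\mathcal{L}$ extends to a self-adjoint non-positive operator on $L^2(\Omega,\mu)$, and $\mathrm{gap}(\mathcal{L})$ is its spectral gap, i.e. the infimum of $\langle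 f,-\mathcal{L}f\rangle_{L^2(\mu)}/\mathrm{Var}_\mu(f)$ over $f$ in the domain with $\mathrm{Var}_\mu(f)>0$. $\mathbb{E}(f(\eta_t))$ denotes the expectation of $f$ at time $t$ over the process started from $\eta$. A path is a sequence $\{x^0,x^1,\dots,x^n\}$ of distinct vertices such that $x^i$ is the parent of $x^{i+1}$ for all $i$. Given $\eta$, write $x\to y$ if there is a path of occupied sites (sites $z$ with $\eta(z)=1$) starting at $x$ and ending at $y$ (so $x\to x$ iff $\eta(x)=1$). The occupied cluster of $x$ is $\mathcal{C}_x(\eta)=\{y\in\mathcal{T}: x\to y\}$. *)

theory Defs
  imports "HOL-Probability.Probability"
begin

text \<open>A vertex is the list of left/right turns on the way from it up to the root \<open>[]\<close>,
  so the head of the list is the last turn taken and the two children of \<open>x\<close> are \<open>b # x\<close>.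
  In a configuration, \<open>True\<close> is the value 1 (occupied) and \<open>False\<close> is the value 0.\<close>

type_synonym vertex = "bool list"
type_synonym config = "vertex \<Rightarrow> bool"

definition parent_of :: "vertex \<Rightarrow> vertex \<Rightarrow> bool" where
  "parent_of x y \<longleftrightarrow> (\<exists>b. y = b # x)"

definition tree_path :: "vertex list \<Rightarrow> bool" where
  "tree_path xs \<longleftrightarrow> xs \<noteq> [] \<and> distinct xs \<and> successively parent_of xs"

definition occ_connected :: "config \<Rightarrow> vertex \<Rightarrow> vertex \<Rightarrow> bool" where
  "occ_connected \<eta> x y \<longleftrightarrow>
     (\<exists>xs. tree_path xs \<and> hd xs = x \<and> last xs = y \<and> (\<forall>z\<in>set xs. \<eta> z))"

definition cluster :: "config \<Rightarrow> vertex \<Rightarrow> vertex set" where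
  "cluster \<eta> x = {y. occ_connected \<eta> x y}"

definition AD_measure :: "real \<Rightarrow> config measure" where
  "AD_measure p = PiM UNIV (\<lambda>x. measure_pmf (bernoulli_pmf p))"

definition local_fun :: "(config \<Rightarrow> real) \<Rightarrow> bool" where
  "local_fun f \<longleftrightarrow>
     (\<exists>S. finite S \<and> (\<forall>\<omega> \<omega>'. (\<forall>x\<in>S. \<omega> x = \<omega>' x) \<longrightarrow> f \<omega> = f \<omega>'))"

definition site_avg :: "real \<Rightarrow> vertex \<Rightarrow> (config \<Rightarrow> real) \<Rightarrow> config \<Rightarrow> real" where
  "site_avg p x f \<omega> = measure_pmf.expectation (bernoulli_pmf p) (\<lambda>b. f (fun_upd \<omega> x b))"

definition AD_rate :: "vertex \<Rightarrow> config \<Rightarrow> real" where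
  "AD_rate x \<omega> = (if \<forall>y. parent_of x y \<longrightarrow> \<not> \<omega> y then 1 else 0)"

text \<open>For a local function only finitely many summands are nonzero.\<close>

definition AD_gen :: "real \<Rightarrow> (config \<Rightarrow> real) \<Rightarrow> config \<Rightarrow> real" where
  "AD_gen p f \<omega> = (\<Sum>\<^sub>\<infinity>x\<in>UNIV. AD_rate x \<omega> * (site_avg p x f \<omega> - f \<omega>))"

text \<open>The self-adjoint extension of the generator to \<open>L\<^sup>2\<close> is the closure of its
  restriction to local functions (which is essentially self-adjoint).
  \<open>AD_L2_gen p f g\<close> says that \<open>f\<close> is in the domain of the closure and \<open>g\<close> is its image;
  functions stand for their almost-everywhere classes.\<close>

definition in_L2 :: "real \<Rightarrow> (config \<Rightarrow> real) \<Rightarrow> bool" where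
  "in_L2 p f \<longleftrightarrow> f \<in> borel_measurable (AD_measure p) \<and> integrable (AD_measure p) (\<lambda>\<omega>. (f \<omega>)\<^sup>2)"

definition AD_L2_gen :: "real \<Rightarrow> (config \<Rightarrow> real) \<Rightarrow> (config \<Rightarrow> real) \<Rightarrow> bool" where
  "AD_L2_gen p f g \<longleftrightarrow> in_L2 p f \<and> in_L2 p g \<and>
     (\<exists>F :: nat \<Rightarrow> config \<Rightarrow> real. (\<forall>n. local_fun (F n)) \<and>
        (\<lambda>n. \<integral>\<omega>. (F n \<omega> - f \<omega>)\<^sup>2 \<partial>AD_measure p) \<longlonglongrightarrow> 0 \<and>
        (\<lambda>n. \<integral>\<omega>. (AD_gen p (F n) \<omega> - g \<omega>)\<^sup>2 \<partial>AD_measure p) \<longlonglongrightarrow> 0)"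

definition AD_mean :: "real \<Rightarrow> (config \<Rightarrow> real) \<Rightarrow> real" where
  "AD_mean p f = (\<integral>\<omega>. f \<omega> \<partial>AD_measure p)"

definition AD_var :: "real \<Rightarrow> (config \<Rightarrow> real) \<Rightarrow> real" where
  "AD_var p f = (\<integral>\<omega>. (f \<omega> - AD_mean p f)\<^sup>2 \<partial>AD_measure p)"

text \<open>Extended-real valued, so that for \<open>p = 0\<close>, where every variance vanishes, the
  infimum over the empty set is \<open>\<infinity>\<close>.\<close>

definition AD_gap :: "real \<Rightarrow> ereal" where
  "AD_gap p = Inf {ereal ((\<integral>\<omega>. f \<omega> * (- g \<omega>) \<partial>AD_measure p) / AD_var p f) | f g.
                     AD_L2_gen p f g \<and> AD_var p f > 0}"

text \<open>Markov (Feller) semigroups on the space of continuous functions on the compact space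
  of configurations. Only \<open>P t f\<close> with \<open>t \<ge> 0\<close> and \<open>f\<close> continuous is constrained.\<close>

definition markov_semigroup :: "(real \<Rightarrow> (config \<Rightarrow> real) \<Rightarrow> config \<Rightarrow> real) \<Rightarrow> bool" where
  "markov_semigroup P \<longleftrightarrow>
     (\<forall>t\<ge>0. \<forall>f. continuous_on UNIV f \<longrightarrow> continuous_on UNIV (P t f)) \<and>
     (\<forall>t\<ge>0. \<forall>f g a b. continuous_on UNIV f \<longrightarrow> continuous_on UNIV g \<longrightarrow>
        P t (\<lambda>\<omega>. a * f \<omega> + b * g \<omega>) = (\<lambda>\<omega>. a * P t f \<omega> + b * P t g \<omega>)) \<and>
     (\<forall>f. continuous_on UNIV f \<longrightarrow> P 0 f = f) \<and>
     (\<forall>s\<ge>0. \<forall>t\<ge>0. \<forall>f. continuous_on UNIV f \<longrightarrow> P (s + t) f = P s (P t f)) \<and>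
     (\<forall>t\<ge>0. P t (\<lambda>_. 1) = (\<lambda>_. 1)) \<and>
     (\<forall>t\<ge>0. \<forall>f. continuous_on UNIV f \<longrightarrow> (\<forall>\<omega>. f \<omega> \<ge> 0) \<longrightarrow> (\<forall>\<omega>. P t f \<omega> \<ge> 0)) \<and>
     (\<forall>s\<ge>0. \<forall>f. continuous_on UNIV f \<longrightarrow> uniform_limit UNIV (\<lambda>t. P t f) (P s f) (at_right s))"

text \<open>The generator of \<open>P\<close> (uniform limit of difference quotients) acts on local functions
  as \<open>AD_gen p\<close>. Local functions are a core, so this determines \<open>P\<close> on continuous functions.\<close>

definition AD_semigroup :: "real \<Rightarrow> (real \<Rightarrow> (config \<Rightarrow> real) \<Rightarrow> config \<Rightarrow> real) \<Rightarrow> bool" where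
  "AD_semigroup p P \<longleftrightarrow> markov_semigroup P \<and>
     (\<forall>f. local_fun f \<longrightarrow>
        uniform_limit UNIV (\<lambda>t \<omega>. (P t f \<omega> - f \<omega>) / t) (AD_gen p f) (at_right 0))"

definition config_space :: "config measure" where
  "config_space = PiM UNIV (\<lambda>_. count_space UNIV)"

definition history :: "'w measure \<Rightarrow> (real \<Rightarrow> 'w \<Rightarrow> config) \<Rightarrow> real \<Rightarrow> 'w measure" where
  "history M X s =
     vimage_algebra (space M) (\<lambda>w. \<lambda>u\<in>{0..s}. X u w) (PiM {0..s} (\<lambda>_. config_space))"

text \<open>\<open>X\<close> is a realisation, on the probability space \<open>M\<close>, of the AD process started from \<open>\<eta>\<close>:
  a Markov process with respect to its natural filtration whose transition semigroup has
  generator \<open>AD_gen p\<close>. Path regularity is not required. The time parameter ranges over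
  \<open>t \<ge> 0\<close>.\<close>

definition AD_process ::
    "real \<Rightarrow> config \<Rightarrow> 'w measure \<Rightarrow> (real \<Rightarrow> 'w \<Rightarrow> config) \<Rightarrow> bool" where
  "AD_process p \<eta> M X \<longleftrightarrow>
     prob_space M \<and>
     (\<forall>t\<ge>0. X t \<in> M \<rightarrow>\<^sub>M config_space) \<and>
     (AE w in M. X 0 w = \<eta>) \<and>
     (\<exists>P. AD_semigroup p P \<and>
        (\<forall>s\<ge>0. \<forall>t\<ge>0. \<forall>f. continuous_on UNIV f \<longrightarrow>
           (AE w in M. real_cond_exp M (history M X s) (\<lambda>w. f (X (s + t) w)) w = P t f (X s w))))"

end

theory Submission
  imports Defs "HOL-Real_Asymp.Real_Asymp"
begin

text \<open>Since the clusters are finite, the support of \<open>f\<close> lies in a finite set \<open>A\<close> of vertices, closed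
  under parents, all of whose outer neighbours are empty in \<open>\<eta>\<close>. As long as these zeros (the
  distinguished zeros) do not move, the dynamics in \<open>A\<close> is reversible with respect to Bernoulli(\<open>p\<close>)
  and, its rates being at least those of the infinite system, has at least the spectral gap of the
  latter, so the variance of the density of the law in \<open>A\<close> contracts exponentially. A distinguished
  zero can only be updated when its two children are empty; it is then at equilibrium and can be
  added to \<open>A\<close> without changing the variance of the density, its children becoming the new
  distinguished zeros. Hence the expectation of \<open>f\<close> converges at any rate below the gap, with a prefactor given by the
  initial density, the point mass at the restriction of \<open>\<eta>\<close> to \<open>A\<close>.

  To avoid constructing the process together with its distinguished zeros, this argument is run as
  an induction over the Euler iterates \<open>(1 + \<epsilon> L\<^sub>n)\<^sup>N f\<close>, where \<open>L\<^sub>n\<close> updates only the vertices of depth at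
  most \<open>n\<close>. These approximate \<open>P\<^sub>t f\<close> for \<open>\<epsilon> = t / N\<close> as first \<open>N\<close> and then \<open>n\<close> tends to infinity, because
  influence only travels from parent to child, so that the sensitivity of the iterates to the spin at \<open>x\<close>
  decays like \<open>4\<close> to the power minus the depth of \<open>x\<close>, faster than the levels grow.\<close>

section \<open>Local functions\<close>

definition depends_on :: "(config \<Rightarrow> real) \<Rightarrow> vertex set \<Rightarrow> bool" where
  "depends_on f S \<longleftrightarrow> (\<forall>\<xi> \<xi>'. (\<forall>x\<in>S. \<xi> x = \<xi>' x) \<longrightarrow> f \<xi> = f \<xi>')"

lemma local_fun_iff: "local_fun f \<longleftrightarrow> (\<exists>S. finite S \<and> depends_on f S)"
  by (simp add: local_fun_def depends_on_def)

lemma depends_onD: "depends_on f S \<Longrightarrow> (\<And>x. x \<in> S \<Longrightarrow> \<xi> x = \<xi>' x) \<Longrightarrow> f \<xi> = f \<xi>'"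
  by (auto simp: depends_on_def)

lemma depends_on_local_fun: "depends_on f S \<Longrightarrow> finite S \<Longrightarrow> local_fun f"
  by (auto simp: local_fun_iff)

lemma depends_on_mono: "depends_on f S \<Longrightarrow> S \<subseteq> T \<Longrightarrow> depends_on f T"
  unfolding depends_on_def by blast

lemma depends_on_upd: "depends_on f S \<Longrightarrow> x \<notin> S \<Longrightarrow> f (\<xi>(x := b)) = f \<xi>"
  by (erule depends_onD) auto

lemma depends_on_comb:
  assumes "depends_on f S" "depends_on g S"
  shows "depends_on (\<lambda>\<xi>. \<phi> (f \<xi>) (g \<xi>)) S"
  unfolding depends_on_def
proof (intro allI impI)
  fix \<xi> \<xi>' :: config assume *: "\<forall>x\<in>S. \<xi> x = \<xi>' x"
  have "f \<xi> = f \<xi>'"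
    by (rule depends_onD[OF assms(1)]) (use * in blast)
  moreover have "g \<xi> = g \<xi>'"
    by (rule depends_onD[OF assms(2)]) (use * in blast)
  ultimately
  show "\<phi> (f \<xi>) (g \<xi>) = \<phi> (f \<xi>') (g \<xi>')" by simp
qed

lemma local_fun_comb:
  assumes "local_fun f" "local_fun g"
  shows "local_fun (\<lambda>\<xi>. \<phi> (f \<xi>) (g \<xi>))"
proof -
  obtain S T where "finite S" "depends_on f S" "finite T" "depends_on g T"
    using assms by (auto simp: local_fun_iff)
  then have "depends_on f (S \<union> T)" "depends_on g (S \<union> T)" "finite (S \<union> T)"
    by (auto elim: depends_on_mono)
  then show ?thesis
    using depends_on_comb[of f "S \<union> T" g \<phi>] depends_on_local_fun by auto
qed

lemma local_fun_const [intro, simp]: "local_fun (\<lambda>_. c)"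
  by (auto simp: local_fun_def)

lemma local_fun_unary: "local_fun f \<Longrightarrow> local_fun (\<lambda>\<xi>. \<phi> (f \<xi>))"
  using local_fun_comb[of f f "\<lambda>a _. \<phi> a"] by simp

lemma local_fun_arith [intro, simp]:
  assumes "local_fun f" "local_fun g"
  shows "local_fun (\<lambda>\<xi>. f \<xi> + g \<xi>)" "local_fun (\<lambda>\<xi>. f \<xi> - g \<xi>)" "local_fun (\<lambda>\<xi>. f \<xi> * g \<xi>)"
  using assms by (auto intro: local_fun_comb)

lemma local_fun_unary_arith [intro, simp]:
  assumes "local_fun f"
  shows "local_fun (\<lambda>\<xi>. - f \<xi>)" "local_fun (\<lambda>\<xi>. (f \<xi>)\<^sup>2)" "local_fun (\<lambda>\<xi>. \<bar>f \<xi>\<bar>)"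
    "local_fun (\<lambda>\<xi>. f \<xi> / c)"
  using assms by (auto intro: local_fun_unary)

lemma local_fun_sum [intro, simp]:
  "(\<And>i. i \<in> I \<Longrightarrow> local_fun (f i)) \<Longrightarrow> local_fun (\<lambda>\<xi>. \<Sum>i\<in>I. f i \<xi>)"
  by (induction I rule: infinite_finite_induct) auto

lemma local_fun_compose:
  assumes "local_fun f" and "\<And>x. \<exists>T. finite T \<and> (\<forall>\<xi> \<xi>'. (\<forall>y\<in>T. \<xi> y = \<xi>' y) \<longrightarrow> \<Phi> \<xi> x = \<Phi> \<xi>' x)"
  shows "local_fun (\<lambda>\<xi>. f (\<Phi> \<xi>))"
proof -
  obtain S where S: "finite S" "depends_on f S"
    using assms by (auto simp: local_fun_iff)
  obtain T where T: "\<And>x. finite (T x)" "\<And>x \<xi> \<xi>'. (\<forall>y\<in>T x. \<xi> y = \<xi>' y) \<Longrightarrow> \<Phi> \<xi> x = \<Phi> \<xi>' x"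
    using assms(2) by metis
  have "depends_on (\<lambda>\<xi>. f (\<Phi> \<xi>)) (\<Union>x\<in>S. T x)"
    unfolding depends_on_def
  proof safe
    fix \<xi> \<xi>' :: config assume "\<forall>y\<in>\<Union>x\<in>S. T x. \<xi> y = \<xi>' y"
    then show "f (\<Phi> \<xi>) = f (\<Phi> \<xi>')"
      by (intro depends_onD[OF S(2)] T(2)) auto
  qed
  then show ?thesis
    using S(1) T(1) depends_on_local_fun by blast
qed

lemma local_fun_upd [intro, simp]:
  assumes "local_fun f"
  shows "local_fun (\<lambda>\<xi>. f (\<xi>(x := b)))"
  using assms by (rule local_fun_compose) (auto intro: exI[of _ "{_}"])

lemma local_fun_override_on [intro, simp]:
  assumes "local_fun f"
  shows "local_fun (\<lambda>\<xi>. f (override_on \<zeta> \<xi> A))"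
  using assms
proof (rule local_fun_compose)
  fix x
  show "\<exists>T. finite T \<and> (\<forall>\<xi> \<xi>'. (\<forall>y\<in>T. \<xi> y = \<xi>' y) \<longrightarrow> override_on \<zeta> \<xi> A x = override_on \<zeta> \<xi>' A x)"
    by (rule exI[of _ "{x}"]) (simp add: override_on_def)
qed

definition cylinder :: "vertex set \<Rightarrow> vertex set \<Rightarrow> config \<Rightarrow> real" where
  "cylinder S \<sigma> \<xi> = of_bool (\<forall>x\<in>S. \<xi> x \<longleftrightarrow> x \<in> \<sigma>)"

lemma local_fun_cylinder [intro, simp]: "finite S \<Longrightarrow> local_fun (cylinder S \<sigma>)"
  unfolding local_fun_def cylinder_def by (rule exI[of _ S]) auto

text \<open>Functions of the spins in \<open>S\<close> form a finite-dimensional space spanned by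
  cylinder indicators, \<open>\<sigma>\<close> being the set of occupied sites. Continuity,
  measurability, boundedness and the uniform generator estimate reduce to these finitely many
  functions.\<close>

lemma depends_on_expand:
  assumes "finite S" "depends_on f S"
  shows "f = (\<lambda>\<xi>. \<Sum>\<sigma>\<in>Pow S. f (\<lambda>x. x \<in> \<sigma>) * cylinder S \<sigma> \<xi>)"
proof
  fix \<xi>
  have "(\<Sum>\<sigma>\<in>Pow S. f (\<lambda>x. x \<in> \<sigma>) * cylinder S \<sigma> \<xi>) = 
        (\<Sum>\<sigma>\<in>Pow S. if \<sigma> = {x\<in>S. \<xi> x} then f (\<lambda>x. x \<in> \<sigma>) else 0)"
    by (intro sum.cong) (auto simp: cylinder_def)
  also have "\<dots> = f (\<lambda>x. x \<in> {x\<in>S. \<xi> x})"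
    using assms(1) by simp
  also have "\<dots> = f \<xi>"
    by (rule depends_onD[OF assms(2)]) auto
  finally show "f \<xi> = (\<Sum>\<sigma>\<in>Pow S. f (\<lambda>x. x \<in> \<sigma>) * cylinder S \<sigma> \<xi>)" ..
qed

lemma cylinder_eq_prod: "finite S \<Longrightarrow> cylinder S \<sigma> \<xi> = (\<Prod>x\<in>S. of_bool (\<xi> x \<longleftrightarrow> x \<in> \<sigma>))"
  by (induction S rule: finite_induct) (auto simp: cylinder_def)

lemma local_fun_continuous [intro]:
  assumes "local_fun f"
  shows "continuous_on UNIV f"
proof -
  obtain S where S: "finite S" "depends_on f S"
    using assms by (auto simp: local_fun_iff)
  have "continuous_on UNIV (\<lambda>\<xi>::config. of_bool (\<xi> x \<longleftrightarrow> x \<in> \<sigma>) :: real)" for x \<sigma>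
    by (rule continuous_on_compose2[of UNIV "\<lambda>b. of_bool (b \<longleftrightarrow> x \<in> \<sigma>)"])
       (auto intro: Topological_Spaces.continuous_on_discrete)
  then show ?thesis
    by (subst depends_on_expand[OF S]) (auto simp: cylinder_eq_prod S intro!: continuous_intros)
qed

lemma local_fun_measurable [intro]:
  assumes "local_fun f"
  shows "f \<in> borel_measurable config_space"
proof -
  obtain S where S: "finite S" "depends_on f S"
    using assms by (auto simp: local_fun_iff)
  have "(\<lambda>\<xi>::config. of_bool (\<xi> x \<longleftrightarrow> x \<in> \<sigma>) :: real) \<in> borel_measurable config_space" for x \<sigma>
    unfolding config_space_def
    by (rule measurable_compose[of "\<lambda>\<xi>. \<xi> x" _ "count_space UNIV" "\<lambda>b. of_bool (b \<longleftrightarrow> x \<in> \<sigma>)"]) auto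
  then show ?thesis
    by (subst depends_on_expand[OF S])
       (auto simp: cylinder_eq_prod S intro!: borel_measurable_sum borel_measurable_prod borel_measurable_times)
qed

lemma local_fun_bounded:
  assumes "local_fun f"
  obtains B where "B \<ge> 0" "\<And>\<xi>. \<bar>f \<xi>\<bar> \<le> B"
proof -
  obtain S where S: "finite S" "depends_on f S"
    using assms by (auto simp: local_fun_iff)
  have "\<bar>f \<xi>\<bar> \<le> (\<Sum>\<sigma>\<in>Pow S. \<bar>f (\<lambda>x. x \<in> \<sigma>)\<bar>)" for \<xi>
    by (subst depends_on_expand[OF S], rule order.trans[OF sum_abs], rule sum_mono)
       (auto simp: cylinder_def abs_mult)
  then show ?thesis
    by (rule that[rotated]) (auto intro: sum_nonneg)
qed

section \<open>Rates, depth levels and the Euler step\<close>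

lemma AD_rate_iff: "AD_rate x \<xi> = (if \<forall>b. \<not> \<xi> (b # x) then 1 else 0)"
  by (auto simp: AD_rate_def parent_of_def)

lemma depends_on_AD_rate: "depends_on (AD_rate x) {True # x, False # x}"
  by (auto simp: depends_on_def AD_rate_iff all_bool_eq)

lemma local_fun_AD_rate [intro, simp]: "local_fun (AD_rate x)"
  using depends_on_AD_rate by (rule depends_on_local_fun) auto

lemma AD_rate_range: "AD_rate x \<xi> = 0 \<or> AD_rate x \<xi> = 1"
  by (auto simp: AD_rate_def)

definition levels :: "nat \<Rightarrow> vertex set" where
  "levels n = {x. length x \<le> n}"

lemma finite_levels [simp]: "finite (levels n)"
  using finite_lists_length_le[of "UNIV :: bool set" n] by (simp add: levels_def)

lemma card_level: "card {x :: vertex. length x = n} = 2 ^ n"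
  using card_lists_length_eq[of "UNIV :: bool set" n] by simp

lemma finite_subset_levels:
  assumes "finite (S :: vertex set)"
  obtains n where "S \<subseteq> levels n"
  by (rule that[of "Max (insert 0 (length ` S))"]) (use assms in \<open>auto simp: levels_def\<close>)

lemma levels_mono: "m \<le> n \<Longrightarrow> levels m \<subseteq> levels n"
  by (auto simp: levels_def)

definition site_gen :: "real \<Rightarrow> vertex \<Rightarrow> (config \<Rightarrow> real) \<Rightarrow> config \<Rightarrow> real" where
  "site_gen p x g \<xi> = AD_rate x \<xi> * (site_avg p x g \<xi> - g \<xi>)"

definition euler :: "real \<Rightarrow> vertex set \<Rightarrow> real \<Rightarrow> (config \<Rightarrow> real) \<Rightarrow> config \<Rightarrow> real" where
  "euler p \<Lambda> \<epsilon> g \<xi> = g \<xi> + \<epsilon> * (\<Sum>x\<in>\<Lambda>. site_gen p x g \<xi>)"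

section \<open>The Bernoulli product measure\<close>

locale bernoulli_tree =
  fixes p :: real
  assumes p_range: "0 \<le> p" "p \<le> 1"
begin

lemma site_avg_eq: "site_avg p x f \<xi> = p * f (\<xi>(x := True)) + (1 - p) * f (\<xi>(x := False))"
  using p_range by (simp add: site_avg_def mult.commute)

lemma local_fun_site_avg [intro, simp]: "local_fun f \<Longrightarrow> local_fun (site_avg p x f)"
  unfolding site_avg_eq[abs_def] by auto

lemma local_fun_site_gen [intro, simp]: "local_fun f \<Longrightarrow> local_fun (site_gen p x f)"
  unfolding site_gen_def by auto

lemma local_fun_euler [intro, simp]: "local_fun f \<Longrightarrow> local_fun (euler p \<Lambda> \<epsilon> f)"
  unfolding euler_def by auto

lemma local_fun_euler_funpow [intro, simp]: "local_fun f \<Longrightarrow> local_fun ((euler p \<Lambda> \<epsilon> ^^ N) f)"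
  by (induction N) auto

lemma site_avg_indep: "depends_on f S \<Longrightarrow> x \<notin> S \<Longrightarrow> site_avg p x f = f"
  by (auto simp: site_avg_eq depends_on_upd algebra_simps)

lemma site_avg_diff_le:
  assumes "\<And>b. \<bar>f (\<xi>(x := b)) - g (\<xi>'(x := b))\<bar> \<le> d"
  shows "\<bar>site_avg p x f \<xi> - site_avg p x g \<xi>'\<bar> \<le> d"
proof -
  have "\<bar>site_avg p x f \<xi> - site_avg p x g \<xi>'\<bar>
      = \<bar>p * (f (\<xi>(x := True)) - g (\<xi>'(x := True))) + (1 - p) * (f (\<xi>(x := False)) - g (\<xi>'(x := False)))\<bar>"
    by (simp add: site_avg_eq algebra_simps)
  also have "\<dots> \<le> p * \<bar>f (\<xi>(x := True)) - g (\<xi>'(x := True))\<bar> + (1 - p) * \<bar>f (\<xi>(x := False)) - g (\<xi>'(x := False))\<bar>"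
    using p_range by (intro order.trans[OF abs_triangle_ineq]) (simp add: abs_mult)
  also have "\<dots> \<le> d"
    using p_range assms by (intro convex_bound_le) auto
  finally show ?thesis .
qed

abbreviation "\<mu> \<equiv> AD_measure p"

sublocale prob_space \<mu>
  unfolding AD_measure_def by (intro prob_space_PiM measure_pmf.prob_space_axioms)

lemma space_AD_measure [simp]: "space \<mu> = UNIV"
  by (simp add: AD_measure_def space_PiM)

lemma prob_UNIV [simp]: "prob UNIV = 1"
  using prob_space by simp

lemma sets_AD_measure: "sets \<mu> = sets config_space"
  unfolding AD_measure_def config_space_def by (intro sets_PiM_cong) auto

lemma local_fun_measurable' [measurable (raw)]: "local_fun f \<Longrightarrow> f \<in> borel_measurable \<mu>"
  using local_fun_measurable measurable_cong_sets[OF sets_AD_measure refl] by blast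

lemma local_fun_integrable [intro, simp]: "local_fun f \<Longrightarrow> integrable \<mu> f"
  by (rule local_fun_bounded[of f], assumption, rule integrable_const_bound) (auto intro: local_fun_measurable')

text \<open>Independent resampling of one coordinate preserves a product measure. Invariance,
  reversibility and the point mass density all rest on this identity.\<close>

lemma expectation_site_avg:
  assumes "local_fun f"
  shows "expectation (site_avg p x f) = expectation f"
proof -
  let ?B = "measure_pmf (bernoulli_pmf p)"
  have eq: "distr (?B \<Otimes>\<^sub>M \<mu>) \<mu> (\<lambda>(b, \<xi>). \<xi>(x := b)) = \<mu>"
    using distr_pair_PiM_eq_PiM[of UNIV "\<lambda>_. ?B" x]
    by (simp add: AD_measure_def measure_pmf.prob_space_axioms)
  interpret P: pair_prob_space ?B \<mu> ..
  have meas: "(\<lambda>(b, \<xi>). \<xi>(x := b)) \<in> ?B \<Otimes>\<^sub>M \<mu> \<rightarrow>\<^sub>M \<mu>"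
    unfolding AD_measure_def case_prod_unfold
    by (rule measurable_fun_upd[where J = UNIV]) auto
  have int: "integrable (?B \<Otimes>\<^sub>M \<mu>) (\<lambda>(b, \<xi>). f (\<xi>(x := b)))"
    using integrable_distr[OF meas, of f] assms eq by (simp add: case_prod_unfold)
  have "expectation f = (\<integral>z. f (case z of (b, \<xi>) \<Rightarrow> \<xi>(x := b)) \<partial>(?B \<Otimes>\<^sub>M \<mu>))"
    by (subst eq[symmetric], rule integral_distr[OF meas]) (use assms in \<open>auto intro: local_fun_measurable'\<close>)
  also have "\<dots> = (\<integral>\<xi>. (\<integral>b. f (\<xi>(x := b)) \<partial>?B) \<partial>\<mu>)"
    using P.integral_snd[of "\<lambda>b \<xi>. f (\<xi>(x := b))"] int by (simp add: case_prod_unfold)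
  finally show ?thesis
    by (simp add: site_avg_def[abs_def])
qed

text \<open>The average over the spin at \<open>x\<close> is a conditional expectation; neither
  \<open>k\<close> nor \<open>site_avg p x v\<close> sees that spin, so both can be taken out of
  it.\<close>

lemma expectation_site_avg_mult:
  assumes "local_fun k" "local_fun u" "local_fun v" and k: "\<And>\<xi> b. k (\<xi>(x := b)) = k \<xi>"
  shows "expectation (\<lambda>\<xi>. k \<xi> * u \<xi> * site_avg p x v \<xi>)
       = expectation (\<lambda>\<xi>. k \<xi> * site_avg p x u \<xi> * site_avg p x v \<xi>)"
proof -
  have "site_avg p x (\<lambda>\<xi>. k \<xi> * u \<xi> * site_avg p x v \<xi>) = (\<lambda>\<xi>. k \<xi> * site_avg p x u \<xi> * site_avg p x v \<xi>)"
    by (auto simp: site_avg_eq k algebra_simps)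
  moreover have "local_fun (\<lambda>\<xi>. k \<xi> * u \<xi> * site_avg p x v \<xi>)"
    using assms by auto
  ultimately show ?thesis
    using expectation_site_avg by metis
qed

lemma expectation_site_avg_swap:
  assumes "local_fun k" "local_fun u" "local_fun v" "\<And>\<xi> b. k (\<xi>(x := b)) = k \<xi>"
  shows "expectation (\<lambda>\<xi>. k \<xi> * u \<xi> * site_avg p x v \<xi>)
       = expectation (\<lambda>\<xi>. k \<xi> * site_avg p x u \<xi> * v \<xi>)"
  using expectation_site_avg_mult[OF assms] expectation_site_avg_mult[OF assms(1,3,2,4)]
  by (simp add: mult_ac)

end

section \<open>Finite regions with empty boundary\<close>

definition parent_closed :: "vertex set \<Rightarrow> bool" where
  "parent_closed A \<longleftrightarrow> (\<forall>b z. b # z \<in> A \<longrightarrow> z \<in> A)"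

definition zero_boundary :: "vertex set \<Rightarrow> config \<Rightarrow> bool" where
  "zero_boundary A \<zeta> \<longleftrightarrow> (\<forall>z\<in>A. \<forall>b. b # z \<notin> A \<longrightarrow> \<not> \<zeta> (b # z))"

definition region_rate :: "vertex set \<Rightarrow> vertex \<Rightarrow> config \<Rightarrow> real" where
  "region_rate A x \<xi> = AD_rate x (override_on (\<lambda>_. False) \<xi> A)"

definition region_gen :: "real \<Rightarrow> vertex set \<Rightarrow> vertex \<Rightarrow> (config \<Rightarrow> real) \<Rightarrow> config \<Rightarrow> real" where
  "region_gen p A x h \<xi> = region_rate A x \<xi> * (site_avg p x h \<xi> - h \<xi>)"

lemma region_rate_UNIV: "region_rate UNIV = AD_rate"
  by (auto simp: fun_eq_iff region_rate_def AD_rate_iff override_on_def)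

lemma site_gen_eq_region_gen: "site_gen p x h = region_gen p UNIV x h"
  by (auto simp: site_gen_def region_gen_def region_rate_UNIV)

lemma AD_rate_override_in:
  "zero_boundary A \<zeta> \<Longrightarrow> x \<in> A \<Longrightarrow> AD_rate x (override_on \<zeta> \<xi> A) = region_rate A x \<xi>"
  by (auto simp: region_rate_def AD_rate_iff zero_boundary_def override_on_def)

lemma AD_rate_override_out:
  "parent_closed A \<Longrightarrow> y \<notin> A \<Longrightarrow> AD_rate y (override_on \<zeta> \<xi> A) = AD_rate y \<zeta>"
  by (auto simp: AD_rate_iff parent_closed_def override_on_def)

lemma region_rate_upd: "region_rate A x (\<xi>(x := b)) = region_rate A x \<xi>"
  by (auto simp: region_rate_def AD_rate_iff override_on_def)

lemma region_rate_range: "region_rate A x \<xi> = 0 \<or> region_rate A x \<xi> = 1"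
  by (auto simp: region_rate_def AD_rate_def)

lemma AD_rate_le_region_rate: "AD_rate x \<xi> \<le> region_rate A x \<xi>"
  by (auto simp: region_rate_def AD_rate_iff override_on_def)

lemma local_fun_region_rate [intro, simp]: "local_fun (region_rate A x)"
  unfolding region_rate_def by auto

lemma depends_on_region_rate: "depends_on (region_rate A x) A"
  unfolding depends_on_def region_rate_def AD_rate_iff override_on_def by auto

context bernoulli_tree
begin

lemma local_fun_region_gen [intro, simp]: "local_fun h \<Longrightarrow> local_fun (region_gen p A x h)"
  unfolding region_gen_def by auto

lemma depends_on_region_gen:
  assumes "depends_on h A"
  shows "depends_on (region_gen p A x h) A"
  unfolding depends_on_def
proof (intro allI impI)
  fix \<xi> \<xi>' :: config assume eq: "\<forall>y\<in>A. \<xi> y = \<xi>' y"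
  have "h (\<xi>(x := b)) = h (\<xi>'(x := b))" for b
    by (rule depends_onD[OF assms]) (use eq in auto)
  moreover have "h \<xi> = h \<xi>'"
    by (rule depends_onD[OF assms]) (use eq in auto)
  moreover have "region_rate A x \<xi> = region_rate A x \<xi>'"
    by (rule depends_onD[OF depends_on_region_rate]) (use eq in auto)
  ultimately show "region_gen p A x h \<xi> = region_gen p A x h \<xi>'"
    by (simp add: region_gen_def site_avg_eq)
qed

lemma site_gen_override_in:
  assumes "zero_boundary A \<zeta>" "x \<in> A"
  shows "site_gen p x g (override_on \<zeta> \<xi> A) = region_gen p A x (\<lambda>\<xi>. g (override_on \<zeta> \<xi> A)) \<xi>"
proof -
  have "(override_on \<zeta> \<xi> A)(x := b) = override_on \<zeta> (\<xi>(x := b)) A" for b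
    using assms(2) by (auto simp: override_on_def fun_eq_iff)
  then show ?thesis
    by (simp add: site_gen_def region_gen_def AD_rate_override_in[OF assms] site_avg_eq)
qed

text \<open>The constraint at \<open>x\<close> reads the children of \<open>x\<close> and not
  \<open>x\<close> itself, so multiplication by the rate commutes with the average over the spin at
  \<open>x\<close>. This reversibility lets the dynamics act on densities instead of
  observables.\<close>

lemma region_gen_adjoint:
  assumes "local_fun u" "local_fun v"
  shows "expectation (\<lambda>\<xi>. u \<xi> * region_gen p A x v \<xi>) = expectation (\<lambda>\<xi>. region_gen p A x u \<xi> * v \<xi>)"
proof -
  let ?k = "region_rate A x"
  have "expectation (\<lambda>\<xi>. u \<xi> * region_gen p A x v \<xi>)
      = expectation (\<lambda>\<xi>. ?k \<xi> * u \<xi> * site_avg p x v \<xi> - ?k \<xi> * u \<xi> * v \<xi>)"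
    by (intro Bochner_Integration.integral_cong) (auto simp: region_gen_def algebra_simps)
  also have "\<dots> = expectation (\<lambda>\<xi>. ?k \<xi> * u \<xi> * site_avg p x v \<xi>) - expectation (\<lambda>\<xi>. ?k \<xi> * u \<xi> * v \<xi>)"
    using assms by (intro Bochner_Integration.integral_diff local_fun_integrable) auto
  also have "expectation (\<lambda>\<xi>. ?k \<xi> * u \<xi> * site_avg p x v \<xi>) = expectation (\<lambda>\<xi>. ?k \<xi> * site_avg p x u \<xi> * v \<xi>)"
    using assms by (intro expectation_site_avg_swap) (auto simp: region_rate_upd)
  also have "\<dots> - expectation (\<lambda>\<xi>. ?k \<xi> * u \<xi> * v \<xi>)
      = expectation (\<lambda>\<xi>. ?k \<xi> * site_avg p x u \<xi> * v \<xi> - ?k \<xi> * u \<xi> * v \<xi>)"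
    using assms by (intro Bochner_Integration.integral_diff[symmetric] local_fun_integrable) auto
  also have "\<dots> = expectation (\<lambda>\<xi>. region_gen p A x u \<xi> * v \<xi>)"
    by (intro Bochner_Integration.integral_cong) (auto simp: region_gen_def algebra_simps)
  finally show ?thesis .
qed

lemma expectation_region_gen:
  assumes "local_fun u"
  shows "expectation (region_gen p A x u) = 0"
  using region_gen_adjoint[of "\<lambda>_. 1" u A x] assms by (simp add: region_gen_def[abs_def] site_avg_eq)

text \<open>The rate is 0 or 1 and does not see the spin at \<open>x\<close>, so
  \<open>- region_gen p A x\<close> is an orthogonal projection and its quadratic form is a squared
  norm.\<close>

lemma region_gen_energy:
  assumes "local_fun u"
  shows "expectation (\<lambda>\<xi>. u \<xi> * region_gen p A x u \<xi>) = - expectation (\<lambda>\<xi>. (region_gen p A x u \<xi>)\<^sup>2)"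
proof -
  let ?k = "region_rate A x" and ?a = "site_avg p x u"
  have swap: "expectation (\<lambda>\<xi>. ?k \<xi> * u \<xi> * ?a \<xi>) = expectation (\<lambda>\<xi>. ?k \<xi> * ?a \<xi> * ?a \<xi>)"
    using assms by (intro expectation_site_avg_mult) (auto simp: region_rate_upd)
  have "u \<xi> * region_gen p A x u \<xi> + (region_gen p A x u \<xi>)\<^sup>2 = ?k \<xi> * ?a \<xi> * ?a \<xi> - ?k \<xi> * u \<xi> * ?a \<xi>" for \<xi>
    using region_rate_range[of A x \<xi>] by (auto simp: region_gen_def power2_eq_square algebra_simps)
  then have "expectation (\<lambda>\<xi>. u \<xi> * region_gen p A x u \<xi> + (region_gen p A x u \<xi>)\<^sup>2)
      = expectation (\<lambda>\<xi>. ?k \<xi> * ?a \<xi> * ?a \<xi>) - expectation (\<lambda>\<xi>. ?k \<xi> * u \<xi> * ?a \<xi>)"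
    using assms by (subst Bochner_Integration.integral_diff[symmetric]) auto
  also have "\<dots> = 0"
    by (simp add: swap)
  finally show ?thesis
    using assms by (subst (asm) Bochner_Integration.integral_add) auto
qed

text \<open>The norm bound for the same projection; it controls the second-order term of an Euler
  step.\<close>

lemma region_gen_square_le:
  assumes "local_fun u"
  shows "expectation (\<lambda>\<xi>. (region_gen p A x u \<xi>)\<^sup>2) \<le> expectation (\<lambda>\<xi>. (u \<xi>)\<^sup>2)"
proof -
  let ?a = "site_avg p x u"
  have swap: "expectation (\<lambda>\<xi>. u \<xi> * ?a \<xi>) = expectation (\<lambda>\<xi>. ?a \<xi> * ?a \<xi>)"
    using assms expectation_site_avg_mult[of "\<lambda>_. 1" u u x] by auto
  have "expectation (\<lambda>\<xi>. (region_gen p A x u \<xi>)\<^sup>2) \<le> expectation (\<lambda>\<xi>. (u \<xi>)\<^sup>2 - u \<xi> * ?a \<xi> + (?a \<xi> * ?a \<xi> - u \<xi> * ?a \<xi>))"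
  proof (rule integral_mono)
    fix \<xi>
    show "(region_gen p A x u \<xi>)\<^sup>2 \<le> (u \<xi>)\<^sup>2 - u \<xi> * ?a \<xi> + (?a \<xi> * ?a \<xi> - u \<xi> * ?a \<xi>)"
      using region_rate_range[of A x \<xi>] zero_le_power2[of "?a \<xi> - u \<xi>"]
      by (auto simp: region_gen_def power2_eq_square algebra_simps)
  qed (use assms in auto)
  also have "\<dots> = expectation (\<lambda>\<xi>. (u \<xi>)\<^sup>2) - expectation (\<lambda>\<xi>. u \<xi> * ?a \<xi>)
      + (expectation (\<lambda>\<xi>. ?a \<xi> * ?a \<xi>) - expectation (\<lambda>\<xi>. u \<xi> * ?a \<xi>))"
    using assms by (subst Bochner_Integration.integral_add Bochner_Integration.integral_diff; auto)+
  also have "\<dots> = expectation (\<lambda>\<xi>. (u \<xi>)\<^sup>2) - expectation (\<lambda>\<xi>. ?a \<xi> * ?a \<xi>)"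
    by (simp add: swap)
  also have "\<dots> \<le> expectation (\<lambda>\<xi>. (u \<xi>)\<^sup>2)"
    by simp
  finally show ?thesis .
qed

section \<open>The Poincare inequality from the spectral gap\<close>

definition poincare :: "real \<Rightarrow> bool" where
  "poincare l \<longleftrightarrow> (\<forall>h A. finite A \<longrightarrow> depends_on h A \<longrightarrow> expectation h = 0 \<longrightarrow>
     l * expectation (\<lambda>\<xi>. (h \<xi>)\<^sup>2) \<le> (\<Sum>x\<in>A. expectation (\<lambda>\<xi>. (site_gen p x h \<xi>)\<^sup>2)))"

lemma AD_gen_eq_sum:
  assumes "finite A" "depends_on h A"
  shows "AD_gen p h = (\<lambda>\<xi>. \<Sum>x\<in>A. site_gen p x h \<xi>)"
proof
  fix \<xi>
  have "AD_gen p h \<xi> = (\<Sum>\<^sub>\<infinity>x\<in>A. AD_rate x \<xi> * (site_avg p x h \<xi> - h \<xi>))"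
    unfolding AD_gen_def by (rule infsum_cong_neutral) (auto simp: site_avg_indep[OF assms(2)])
  then show "AD_gen p h \<xi> = (\<Sum>x\<in>A. site_gen p x h \<xi>)"
    using assms(1) by (simp add: site_gen_def)
qed

lemma local_fun_AD_gen [intro, simp]:
  assumes "local_fun h"
  shows "local_fun (AD_gen p h)"
proof -
  obtain S where "finite S" "depends_on h S"
    using assms by (auto simp: local_fun_iff)
  then show ?thesis
    using assms by (auto simp: AD_gen_eq_sum)
qed

lemma AD_L2_gen_local_fun: "local_fun h \<Longrightarrow> AD_L2_gen p h (AD_gen p h)"
  unfolding AD_L2_gen_def in_L2_def
  by (auto intro!: local_fun_measurable' local_fun_integrable exI[of _ "\<lambda>_. h"])

text \<open>The sum of squared norms is the Dirichlet form of \<open>h\<close>, and a local function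
  lies in the domain of the generator, so it competes in the infimum defining the gap.\<close>

lemma poincare_of_gap:
  assumes "AD_gap p > 0"
  obtains l where "l > 0" "poincare l"
proof -
  \<comment> \<open>The gap may be infinite, so a real rate strictly below it is fixed.\<close>
  obtain l where l: "0 < ereal l" "ereal l < AD_gap p"
    using ereal_dense2[OF assms] by auto
  have "l * expectation (\<lambda>\<xi>. (h \<xi>)\<^sup>2) \<le> (\<Sum>x\<in>A. expectation (\<lambda>\<xi>. (site_gen p x h \<xi>)\<^sup>2))"
    if A: "finite A" "depends_on h A" and mean: "expectation h = 0" for h A
  proof -
    have loc: "local_fun h"
      using A by (auto intro: depends_on_local_fun)
    have var: "AD_var p h = expectation (\<lambda>\<xi>. (h \<xi>)\<^sup>2)"
      by (simp add: AD_var_def AD_mean_def mean)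
    have "expectation (\<lambda>\<xi>. h \<xi> * - AD_gen p h \<xi>) = expectation (\<lambda>\<xi>. \<Sum>x\<in>A. - (h \<xi> * site_gen p x h \<xi>))"
      by (simp add: AD_gen_eq_sum[OF A] sum_distrib_left sum_negf)
    also have "\<dots> = (\<Sum>x\<in>A. - expectation (\<lambda>\<xi>. h \<xi> * site_gen p x h \<xi>))"
      using loc by (subst Bochner_Integration.integral_sum) auto
    also have "\<dots> = (\<Sum>x\<in>A. expectation (\<lambda>\<xi>. (site_gen p x h \<xi>)\<^sup>2))"
      using loc by (simp add: site_gen_eq_region_gen region_gen_energy)
    finally have energy: "expectation (\<lambda>\<xi>. h \<xi> * - AD_gen p h \<xi>) = (\<Sum>x\<in>A. expectation (\<lambda>\<xi>. (site_gen p x h \<xi>)\<^sup>2))" .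
    show ?thesis
    proof (cases "AD_var p h > 0")
      case True
      have "AD_gap p \<le> ereal (expectation (\<lambda>\<xi>. h \<xi> * - AD_gen p h \<xi>) / AD_var p h)"
        unfolding AD_gap_def by (rule Inf_lower) (use AD_L2_gen_local_fun[OF loc] True in blast)
      with l(2) have "ereal l < ereal (expectation (\<lambda>\<xi>. h \<xi> * - AD_gen p h \<xi>) / AD_var p h)"
        by (rule less_le_trans)
      then have "l * AD_var p h < expectation (\<lambda>\<xi>. h \<xi> * - AD_gen p h \<xi>)"
        using pos_less_divide_eq[OF True] by (simp only: less_ereal.simps)
      then show ?thesis
        unfolding energy var by simp
    next
      case False
      then have "expectation (\<lambda>\<xi>. (h \<xi>)\<^sup>2) \<le> 0"
        by (simp add: var)
      then have "l * expectation (\<lambda>\<xi>. (h \<xi>)\<^sup>2) \<le> 0"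
        using l by (simp add: mult_nonneg_nonpos)
      also have "0 \<le> (\<Sum>x\<in>A. expectation (\<lambda>\<xi>. (site_gen p x h \<xi>)\<^sup>2))"
        by (intro sum_nonneg) simp
      finally show ?thesis .
    qed
  qed
  then show ?thesis
    using l by (intro that[of l]) (auto simp: poincare_def)
qed

text \<open>Emptying the sites outside the region only increases the rates, hence the Dirichlet form, so
  the Poincare inequality passes from the infinite tree to the region.\<close>

lemma poincare_region:
  assumes "poincare l" "finite A" "depends_on u A" "expectation u = 0"
  shows "l * expectation (\<lambda>\<xi>. (u \<xi>)\<^sup>2) \<le> (\<Sum>x\<in>A. expectation (\<lambda>\<xi>. (region_gen p A x u \<xi>)\<^sup>2))"
proof -
  have loc: "local_fun u"
    using assms by (auto intro: depends_on_local_fun)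
  have "(site_gen p x u \<xi>)\<^sup>2 \<le> (region_gen p A x u \<xi>)\<^sup>2" for x \<xi>
    using AD_rate_le_region_rate[of x \<xi> A] AD_rate_range[of x \<xi>] region_rate_range[of A x \<xi>]
    by (auto simp: site_gen_def region_gen_def)
  then have "(\<Sum>x\<in>A. expectation (\<lambda>\<xi>. (site_gen p x u \<xi>)\<^sup>2)) \<le> (\<Sum>x\<in>A. expectation (\<lambda>\<xi>. (region_gen p A x u \<xi>)\<^sup>2))"
    using loc by (intro sum_mono integral_mono) auto
  moreover have "l * expectation (\<lambda>\<xi>. (u \<xi>)\<^sup>2) \<le> (\<Sum>x\<in>A. expectation (\<lambda>\<xi>. (site_gen p x u \<xi>)\<^sup>2))"
    using assms unfolding poincare_def by blast
  ultimately show ?thesis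
    by linarith
qed

text \<open>\<open>h'\<close> is the density after one Euler step in \<open>A\<close>, damped by
  \<open>a\<close>. The Poincare inequality controls the cross term, the projection bound the
  second-order term. The factor is a perfect square because \<open>contracts\<close> measures
  deviations by a standard deviation \<open>B\<close>.\<close>

lemma region_step_variance:
  assumes l: "poincare l" and A: "finite A" "depends_on h A"
    and a: "1 / 2 \<le> a" "a \<le> 1" and \<epsilon>: "0 \<le> \<epsilon>" "\<epsilon> * l \<le> 1 / 4"
  defines "h' \<equiv> \<lambda>\<xi>. a * h \<xi> + \<epsilon> * (\<Sum>x\<in>A. region_gen p A x h \<xi>)"
  shows "expectation h' = a * expectation h"
    and "expectation (\<lambda>\<xi>. (h' \<xi> - expectation h')\<^sup>2)
       \<le> expectation (\<lambda>\<xi>. (h \<xi> - expectation h)\<^sup>2) * (a - \<epsilon> * l + \<epsilon>\<^sup>2 * (real (card A))\<^sup>2)\<^sup>2"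
proof -
  have loc: "local_fun h"
    using A by (auto intro: depends_on_local_fun)
  then show mean: "expectation h' = a * expectation h"
    unfolding h'_def by (simp add: expectation_region_gen)
  define u where "u \<xi> = h \<xi> - expectation h" for \<xi>
  define w where "w \<xi> = (\<Sum>x\<in>A. region_gen p A x u \<xi>)" for \<xi>
  let ?V = "expectation (\<lambda>\<xi>. (u \<xi>)\<^sup>2)" and ?K = "real (card A)"
  have uloc [simp, intro]: "local_fun u" and u_dep: "depends_on u A" and wloc [simp, intro]: "local_fun w"
    using loc depends_on_comb[OF A(2,2), of "\<lambda>a _. a - expectation h"] by (auto simp: u_def[abs_def] w_def[abs_def])
  have u_mean: "expectation u = 0"
    using loc by (simp add: u_def[abs_def])
  have gen_u: "region_gen p A x h = region_gen p A x u" for x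
    by (auto simp: region_gen_def u_def site_avg_eq algebra_simps)
  have h': "h' \<xi> - expectation h' = a * u \<xi> + \<epsilon> * w \<xi>" for \<xi>
    unfolding mean by (simp add: h'_def u_def w_def gen_u algebra_simps)
  have "expectation (\<lambda>\<xi>. u \<xi> * w \<xi>) = - (\<Sum>x\<in>A. expectation (\<lambda>\<xi>. (region_gen p A x u \<xi>)\<^sup>2))"
    by (simp add: w_def sum_distrib_left region_gen_energy sum_negf)
  then have uw: "expectation (\<lambda>\<xi>. u \<xi> * w \<xi>) \<le> - (l * ?V)"
    using poincare_region[OF l A(1) u_dep u_mean] by simp
  \<comment> \<open>Cauchy-Schwarz over the sites, then the projection bound for each of
    them.\<close>
  have "expectation (\<lambda>\<xi>. (w \<xi>)\<^sup>2) \<le> expectation (\<lambda>\<xi>. ?K * (\<Sum>x\<in>A. (region_gen p A x u \<xi>)\<^sup>2))"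
    unfolding w_def using sum_squared_le_sum_of_squares
    by (intro integral_mono) (auto simp: mult.commute)
  also have "\<dots> = ?K * (\<Sum>x\<in>A. expectation (\<lambda>\<xi>. (region_gen p A x u \<xi>)\<^sup>2))"
    by simp
  also have "\<dots> \<le> ?K * (\<Sum>x\<in>A. ?V)"
    by (intro mult_left_mono sum_mono region_gen_square_le) auto
  finally have ww: "expectation (\<lambda>\<xi>. (w \<xi>)\<^sup>2) \<le> ?K\<^sup>2 * ?V"
    by (simp add: power2_eq_square)
  have "expectation (\<lambda>\<xi>. (h' \<xi> - expectation h')\<^sup>2)
      = expectation (\<lambda>\<xi>. a\<^sup>2 * (u \<xi>)\<^sup>2 + 2 * a * \<epsilon> * (u \<xi> * w \<xi>) + \<epsilon>\<^sup>2 * (w \<xi>)\<^sup>2)"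
    unfolding h' by (simp add: power2_eq_square algebra_simps)
  also have "\<dots> = a\<^sup>2 * ?V + 2 * a * \<epsilon> * expectation (\<lambda>\<xi>. u \<xi> * w \<xi>) + \<epsilon>\<^sup>2 * expectation (\<lambda>\<xi>. (w \<xi>)\<^sup>2)"
    by simp
  also have "\<dots> \<le> a\<^sup>2 * ?V + 2 * a * \<epsilon> * (- (l * ?V)) + \<epsilon>\<^sup>2 * (?K\<^sup>2 * ?V)"
    using uw ww a \<epsilon> by (intro add_mono mult_left_mono) auto
  also have "\<dots> = ?V * (a\<^sup>2 - 2 * a * (\<epsilon> * l) + \<epsilon>\<^sup>2 * ?K\<^sup>2)"
    by (simp add: algebra_simps)
  also have "\<dots> \<le> ?V * (a - \<epsilon> * l + \<epsilon>\<^sup>2 * ?K\<^sup>2)\<^sup>2"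
  proof (rule mult_left_mono)
    \<comment> \<open>Since \<open>1 / 2 \<le> a\<close>, the mixed term \<open>2 * a * c\<close> of
      the completed square pays for the second-order error \<open>c\<close>.\<close>
    define c where "c = \<epsilon>\<^sup>2 * ?K\<^sup>2"
    have "c \<ge> 0"
      by (simp add: c_def)
    then have "c \<le> 2 * a * c"
      using a(1) mult_right_mono[of 1 "2 * a" c] by simp
    moreover have "(a - \<epsilon> * l + c)\<^sup>2 = a\<^sup>2 - 2 * a * (\<epsilon> * l) + 2 * a * c + (c - \<epsilon> * l)\<^sup>2"
      by (simp add: power2_eq_square algebra_simps)
    ultimately show "a\<^sup>2 - 2 * a * (\<epsilon> * l) + \<epsilon>\<^sup>2 * ?K\<^sup>2 \<le> (a - \<epsilon> * l + \<epsilon>\<^sup>2 * ?K\<^sup>2)\<^sup>2"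
      unfolding c_def[symmetric] by (smt (verit) zero_le_power2)
  qed simp
  finally show "expectation (\<lambda>\<xi>. (h' \<xi> - expectation h')\<^sup>2)
       \<le> expectation (\<lambda>\<xi>. (h \<xi> - expectation h)\<^sup>2) * (a - \<epsilon> * l + \<epsilon>\<^sup>2 * ?K\<^sup>2)\<^sup>2"
    by (simp add: u_def)
qed

end

section \<open>Contraction by distinguished zeros\<close>

context bernoulli_tree
begin

text \<open>\<open>g\<close> is averaged against a signed law on the region \<open>A\<close> with density \<open>h\<close>, the configuration
  outside \<open>A\<close> being frozen to \<open>\<zeta>\<close>, whose zeros next to \<open>A\<close> are the distinguished ones. The set \<open>S\<close>
  supports the observable, and \<open>R\<close> is uniform in \<open>A\<close> and \<open>\<zeta>\<close>, which both change along the dynamics.\<close>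

definition contracts :: "vertex set \<Rightarrow> vertex set \<Rightarrow> (config \<Rightarrow> real) \<Rightarrow> real \<Rightarrow> real \<Rightarrow> bool" where
  "contracts \<Lambda> S g m R \<longleftrightarrow> (\<forall>A \<zeta> h B. S \<subseteq> A \<longrightarrow> A \<subseteq> \<Lambda> \<longrightarrow> parent_closed A \<longrightarrow> zero_boundary A \<zeta> \<longrightarrow>
     depends_on h A \<longrightarrow> 0 < B \<longrightarrow> expectation (\<lambda>\<xi>. (h \<xi> - expectation h)\<^sup>2) \<le> B\<^sup>2 \<longrightarrow>
     \<bar>expectation (\<lambda>\<xi>. h \<xi> * g (override_on \<zeta> \<xi> A)) - m * expectation h\<bar> \<le> R * B)"

lemma contractsD:
  assumes "contracts \<Lambda> S g m R" "S \<subseteq> A" "A \<subseteq> \<Lambda>" "parent_closed A" "zero_boundary A \<zeta>"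
    "depends_on h A" "0 < B" "expectation (\<lambda>\<xi>. (h \<xi> - expectation h)\<^sup>2) \<le> B\<^sup>2"
  shows "\<bar>expectation (\<lambda>\<xi>. h \<xi> * g (override_on \<zeta> \<xi> A)) - m * expectation h\<bar> \<le> R * B"
  using assms unfolding contracts_def by blast

text \<open>Base of the induction over Euler steps: as \<open>f\<close> only sees \<open>A\<close>,
  the deviation is the covariance of \<open>h\<close> and \<open>f\<close> under
  \<open>\<mu>\<close>.\<close>

lemma contracts_self:
  assumes "finite S" "depends_on f S" "finite \<Lambda>" "\<And>\<xi>. \<bar>f \<xi>\<bar> \<le> C"
  shows "contracts \<Lambda> S f (expectation f) ((1 + C\<^sup>2) / 2)"
  unfolding contracts_def
proof (intro allI impI)
  fix A \<zeta> h B
  assume A: "S \<subseteq> A" "A \<subseteq> \<Lambda>" and h: "depends_on h A" and B: "0 < B"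
    and V: "expectation (\<lambda>\<xi>. (h \<xi> - expectation h)\<^sup>2) \<le> B\<^sup>2"
  have loc: "local_fun f" "local_fun h"
    using assms A h finite_subset[of A \<Lambda>] by (auto intro: depends_on_local_fun)
  let ?u = "\<lambda>\<xi>. h \<xi> - expectation h"
  have "f (override_on \<zeta> \<xi> A) = f \<xi>" for \<xi>
    by (rule depends_onD[OF assms(2)]) (use A in \<open>auto simp: override_on_def\<close>)
  then have "expectation (\<lambda>\<xi>. h \<xi> * f (override_on \<zeta> \<xi> A)) - expectation f * expectation h
      = expectation (\<lambda>\<xi>. ?u \<xi> * f \<xi>)"
    using loc by (simp add: left_diff_distrib)
  moreover have "\<bar>expectation (\<lambda>\<xi>. ?u \<xi> * f \<xi>)\<bar> \<le> expectation (\<lambda>\<xi>. ((?u \<xi>)\<^sup>2 / B + B * C\<^sup>2) / 2)"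
  proof (rule integral_abs_bound[THEN order.trans], rule integral_mono)
    fix \<xi>
    have "(f \<xi>)\<^sup>2 \<le> C\<^sup>2"
      using power_mono[OF assms(4)[of \<xi>], of 2] by simp
    \<comment> \<open>Weighting Young's inequality by \<open>B\<close> keeps the final bound linear
      in \<open>B\<close>.\<close>
    have "2 * B * \<bar>c * f \<xi>\<bar> \<le> c\<^sup>2 + B\<^sup>2 * (f \<xi>)\<^sup>2" for c
      using zero_le_power2[of "\<bar>c\<bar> - B * \<bar>f \<xi>\<bar>"]
      by (simp add: power2_diff power_mult_distrib abs_mult algebra_simps)
    then have "2 * B * \<bar>?u \<xi> * f \<xi>\<bar> \<le> (?u \<xi>)\<^sup>2 + B\<^sup>2 * (f \<xi>)\<^sup>2" .
    also have "\<dots> \<le> (?u \<xi>)\<^sup>2 + B\<^sup>2 * C\<^sup>2"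
      using \<open>(f \<xi>)\<^sup>2 \<le> C\<^sup>2\<close> by (simp add: mult_left_mono)
    finally show "\<bar>?u \<xi> * f \<xi>\<bar> \<le> ((?u \<xi>)\<^sup>2 / B + B * C\<^sup>2) / 2"
      using B by (simp add: field_simps power2_eq_square)
  qed (use loc in auto)
  moreover have "expectation (\<lambda>\<xi>. ((?u \<xi>)\<^sup>2 / B + B * C\<^sup>2) / 2) = (expectation (\<lambda>\<xi>. (?u \<xi>)\<^sup>2) / B + B * C\<^sup>2) / 2"
    using loc by simp
  moreover have "expectation (\<lambda>\<xi>. (?u \<xi>)\<^sup>2) / B \<le> B"
    using V B by (simp add: pos_divide_le_eq power2_eq_square)
  ultimately show "\<bar>expectation (\<lambda>\<xi>. h \<xi> * f (override_on \<zeta> \<xi> A)) - expectation f * expectation h\<bar> \<le> (1 + C\<^sup>2) / 2 * B"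
    by (simp add: algebra_simps)
qed

text \<open>Updates inside \<open>A\<close> are moved to the density by reversibility and shrink its
  variance. Each update outside \<open>A\<close> yields integrals of the kind that the hypothesis on
  \<open>g\<close> bounds, possibly for a new region or frozen configuration. The weights add up to
  one, and the gain \<open>\<epsilon> * l\<close> comes from the inside part.\<close>

lemma contracts_euler:
  fixes \<epsilon> :: real
  assumes l: "poincare l" and \<Lambda>: "finite \<Lambda>" and g: "local_fun g" and R: "0 \<le> R"
    and g_contr: "contracts \<Lambda> S g m R"
    and \<epsilon>: "0 \<le> \<epsilon>" "\<epsilon> * card \<Lambda> \<le> 1 / 2" "\<epsilon> * l \<le> 1 / 4"
  shows "contracts \<Lambda> S (euler p \<Lambda> \<epsilon> g) m (R * (1 - \<epsilon> * l + \<epsilon>\<^sup>2 * (real (card \<Lambda>))\<^sup>2))"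
  unfolding contracts_def
proof (intro allI impI)
  fix A \<zeta> h B
  assume A: "S \<subseteq> A" "A \<subseteq> \<Lambda>" and closed: "parent_closed A" and zb: "zero_boundary A \<zeta>"
    and h: "depends_on h A" and B: "0 < B" and V: "expectation (\<lambda>\<xi>. (h \<xi> - expectation h)\<^sup>2) \<le> B\<^sup>2"
  have finA: "finite A"
    using A \<Lambda> by (auto intro: finite_subset)
  have hloc [simp]: "local_fun h"
    using h finA by (auto intro: depends_on_local_fun)
  note [simp] = g
  let ?F = "\<lambda>h. expectation (\<lambda>\<xi>. h \<xi> * g (override_on \<zeta> \<xi> A))"
  define k where "k = real (card (\<Lambda> - A))"
  \<comment> \<open>Each of the \<open>k\<close> sites outside \<open>A\<close> takes a share
    \<open>\<epsilon>\<close> of the identity to complete its generator to an update;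
    \<open>a\<close> is the share left for the inside.\<close>
  define a where "a = 1 - \<epsilon> * k"
  define h' where "h' \<xi> = a * h \<xi> + \<epsilon> * (\<Sum>x\<in>A. region_gen p A x h \<xi>)" for \<xi>
  have "\<epsilon> * k \<le> \<epsilon> * card \<Lambda>"
    using \<epsilon> \<Lambda> unfolding k_def by (intro mult_left_mono) (auto intro: card_mono)
  then have a: "1 / 2 \<le> a" "a \<le> 1"
    using \<epsilon> by (auto simp: a_def k_def)
  have h'_dep: "depends_on h' A"
    unfolding depends_on_def
  proof (intro allI impI)
    fix \<xi> \<xi>' :: config assume eq: "\<forall>x\<in>A. \<xi> x = \<xi>' x"
    have "h \<xi> = h \<xi>'"
      by (rule depends_onD[OF h]) (use eq in auto)
    moreover have "region_gen p A x h \<xi> = region_gen p A x h \<xi>'" for x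
      by (rule depends_onD[OF depends_on_region_gen[OF h]]) (use eq in auto)
    ultimately show "h' \<xi> = h' \<xi>'"
      by (simp add: h'_def)
  qed
  have h'loc [simp]: "local_fun h'"
    using h'_dep finA by (auto intro: depends_on_local_fun)

  have inside: "expectation (\<lambda>\<xi>. h \<xi> * site_gen p x g (override_on \<zeta> \<xi> A)) = ?F (region_gen p A x h)"
    if "x \<in> A" for x
    using that zb by (simp add: site_gen_override_in region_gen_adjoint)

  have outside: "\<bar>expectation (\<lambda>\<xi>. h \<xi> * site_gen p y g (override_on \<zeta> \<xi> A)) + ?F h - m * expectation h\<bar> \<le> R * B"
    if y: "y \<in> \<Lambda>" "y \<notin> A" for y
  proof (cases "AD_rate y \<zeta> = 0")
    case True
    \<comment> \<open>An update blocked by the constraint changes nothing.\<close>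
    then show ?thesis
      using contractsD[OF g_contr A closed zb h B V] y closed
      by (simp add: site_gen_def AD_rate_override_out)
  next
    case False
    then have rate: "AD_rate y \<zeta> = 1"
      using AD_rate_range by auto
    have y_children: "b # y \<notin> A" "\<not> \<zeta> (b # y)" for b
      using False y closed by (auto simp: AD_rate_iff parent_closed_def split: if_splits)
    have "h \<xi> * site_gen p y g (override_on \<zeta> \<xi> A) + h \<xi> * g (override_on \<zeta> \<xi> A)
        = h \<xi> * site_avg p y g (override_on \<zeta> \<xi> A)" for \<xi>
      using y closed by (simp add: site_gen_def AD_rate_override_out rate algebra_simps)
    then have avg: "expectation (\<lambda>\<xi>. h \<xi> * site_gen p y g (override_on \<zeta> \<xi> A)) + ?F h
        = expectation (\<lambda>\<xi>. h \<xi> * site_avg p y g (override_on \<zeta> \<xi> A))"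
      by (subst Bochner_Integration.integral_add[symmetric]) auto
    show ?thesis
    proof (cases "\<exists>b z. y = b # z \<and> z \<in> A")
      case True
      \<comment> \<open>A distinguished zero is updated: its site is now in equilibrium, so it joins the region with
        the density unchanged, and its two children, empty because the update was legal, take over.\<close>
      let ?A = "insert y A"
      have "site_avg p y g (override_on \<zeta> \<xi> A) = site_avg p y (\<lambda>\<xi>. g (override_on \<zeta> \<xi> ?A)) \<xi>" for \<xi>
      proof -
        have "(override_on \<zeta> \<xi> A)(y := b) = override_on \<zeta> (\<xi>(y := b)) ?A" for b
          using y by (auto simp: override_on_def fun_eq_iff)
        then show ?thesis
          by (simp add: site_avg_eq)
      qed
      then have "expectation (\<lambda>\<xi>. h \<xi> * site_avg p y g (override_on \<zeta> \<xi> A))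
          = expectation (\<lambda>\<xi>. site_avg p y h \<xi> * g (override_on \<zeta> \<xi> ?A))"
        using expectation_site_avg_swap[of "\<lambda>_. 1" h "\<lambda>\<xi>. g (override_on \<zeta> \<xi> ?A)" y] by simp
      then have "expectation (\<lambda>\<xi>. h \<xi> * site_avg p y g (override_on \<zeta> \<xi> A))
          = expectation (\<lambda>\<xi>. h \<xi> * g (override_on \<zeta> \<xi> ?A))"
        using site_avg_indep[OF h y(2)] by simp
      moreover have "\<bar>expectation (\<lambda>\<xi>. h \<xi> * g (override_on \<zeta> \<xi> ?A)) - m * expectation h\<bar> \<le> R * B"
      proof (rule contractsD[OF g_contr _ _ _ _ _ B V])
        show "parent_closed ?A"
          using closed True by (auto simp: parent_closed_def)
        show "zero_boundary ?A \<zeta>"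
          using zb y_children by (auto simp: zero_boundary_def)
        show "depends_on h ?A"
          using h by (rule depends_on_mono) auto
      qed (use A y in auto)
      ultimately show ?thesis
        by (simp add: avg)
    next
      case False
      \<comment> \<open>Here \<open>y\<close> is not a child of a site of \<open>A\<close>, so
        resampling it merely mixes two frozen configurations, both with empty boundary.\<close>
      let ?G = "\<lambda>b. expectation (\<lambda>\<xi>. h \<xi> * g (override_on (\<zeta>(y := b)) \<xi> A))"
      have "(override_on \<zeta> \<xi> A)(y := b) = override_on (\<zeta>(y := b)) \<xi> A" for \<xi> b
        using y by (auto simp: override_on_def fun_eq_iff)
      then have "expectation (\<lambda>\<xi>. h \<xi> * site_avg p y g (override_on \<zeta> \<xi> A))
          = expectation (\<lambda>\<xi>. p * (h \<xi> * g (override_on (\<zeta>(y := True)) \<xi> A))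
                           + (1 - p) * (h \<xi> * g (override_on (\<zeta>(y := False)) \<xi> A)))"
        by (simp add: site_avg_eq algebra_simps)
      also have "\<dots> = p * ?G True + (1 - p) * ?G False"
        by (subst Bochner_Integration.integral_add) auto
      finally have "\<bar>expectation (\<lambda>\<xi>. h \<xi> * site_avg p y g (override_on \<zeta> \<xi> A)) - m * expectation h\<bar>
          = \<bar>p * (?G True - m * expectation h) + (1 - p) * (?G False - m * expectation h)\<bar>"
        by (simp add: algebra_simps)
      also have "\<dots> \<le> p * \<bar>?G True - m * expectation h\<bar> + (1 - p) * \<bar>?G False - m * expectation h\<bar>"
        using p_range by (intro order.trans[OF abs_triangle_ineq]) (simp add: abs_mult)
      also have "\<dots> \<le> R * B"
      proof (intro convex_bound_le)
        have "zero_boundary A (\<zeta>(y := b))" for b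
          using zb False by (auto simp: zero_boundary_def)
        then have "\<bar>?G b - m * expectation h\<bar> \<le> R * B" for b
          by (rule contractsD[OF g_contr A closed _ h B V])
        then show "\<bar>?G True - m * expectation h\<bar> \<le> R * B" "\<bar>?G False - m * expectation h\<bar> \<le> R * B"
          by this+
      qed (use p_range in auto)
      finally show ?thesis
        by (simp add: avg)
    qed
  qed

  \<comment> \<open>Using \<open>card \<Lambda>\<close> rather than \<open>card A\<close> keeps the
    factor the same while \<open>A\<close> grows.\<close>
  let ?r = "a - \<epsilon> * l + \<epsilon>\<^sup>2 * (real (card \<Lambda>))\<^sup>2"
  have mean': "expectation h' = a * expectation h"
    unfolding h'_def by (rule region_step_variance[OF l finA h a \<epsilon>(1,3)])
  have "\<bar>?F h' - m * expectation h'\<bar> \<le> R * (B * ?r)"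
  proof (rule contractsD[OF g_contr A closed zb h'_dep])
    have r: "0 < a - \<epsilon> * l"
      using a \<epsilon> by linarith
    then show "0 < B * ?r"
      using B by (intro mult_pos_pos add_pos_nonneg) auto
    have "expectation (\<lambda>\<xi>. (h' \<xi> - expectation h')\<^sup>2)
        \<le> expectation (\<lambda>\<xi>. (h \<xi> - expectation h)\<^sup>2) * (a - \<epsilon> * l + \<epsilon>\<^sup>2 * (real (card A))\<^sup>2)\<^sup>2"
      unfolding h'_def by (rule region_step_variance[OF l finA h a \<epsilon>(1,3)])
    also have "\<dots> \<le> B\<^sup>2 * ?r\<^sup>2"
      using V A \<Lambda> r by (intro mult_mono power_mono add_left_mono mult_left_mono) (auto intro: card_mono)
    finally show "expectation (\<lambda>\<xi>. (h' \<xi> - expectation h')\<^sup>2) \<le> (B * ?r)\<^sup>2"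
      by (simp add: power_mult_distrib)
  qed
  moreover have "\<bar>\<Sum>y\<in>\<Lambda> - A. expectation (\<lambda>\<xi>. h \<xi> * site_gen p y g (override_on \<zeta> \<xi> A)) + ?F h - m * expectation h\<bar> \<le> k * (R * B)"
    unfolding k_def using outside by (intro order.trans[OF sum_abs] sum_bounded_above) auto
  moreover have "expectation (\<lambda>\<xi>. h \<xi> * euler p \<Lambda> \<epsilon> g (override_on \<zeta> \<xi> A)) - m * expectation h
     = (?F h' - m * expectation h')
       + \<epsilon> * (\<Sum>y\<in>\<Lambda> - A. expectation (\<lambda>\<xi>. h \<xi> * site_gen p y g (override_on \<zeta> \<xi> A)) + ?F h - m * expectation h)"
  proof -
    let ?D = "\<lambda>x. expectation (\<lambda>\<xi>. h \<xi> * site_gen p x g (override_on \<zeta> \<xi> A))"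
    have "expectation (\<lambda>\<xi>. h \<xi> * euler p \<Lambda> \<epsilon> g (override_on \<zeta> \<xi> A))
        = expectation (\<lambda>\<xi>. h \<xi> * g (override_on \<zeta> \<xi> A) + \<epsilon> * (\<Sum>x\<in>\<Lambda>. h \<xi> * site_gen p x g (override_on \<zeta> \<xi> A)))"
      by (simp add: euler_def algebra_simps sum_distrib_left)
    also have "\<dots> = ?F h + \<epsilon> * (\<Sum>x\<in>\<Lambda>. ?D x)"
      by simp
    also have "(\<Sum>x\<in>\<Lambda>. ?D x) = (\<Sum>x\<in>\<Lambda> - A. ?D x) + (\<Sum>x\<in>A. ?D x)"
      by (rule sum.subset_diff[OF A(2) \<Lambda>])
    also have "(\<Sum>x\<in>A. ?D x) = (\<Sum>x\<in>A. ?F (region_gen p A x h))"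
      by (intro sum.cong inside) auto
    finally have 1: "expectation (\<lambda>\<xi>. h \<xi> * euler p \<Lambda> \<epsilon> g (override_on \<zeta> \<xi> A))
       = ?F h + \<epsilon> * ((\<Sum>x\<in>\<Lambda> - A. ?D x) + (\<Sum>x\<in>A. ?F (region_gen p A x h)))" .
    have "?F h' = expectation (\<lambda>\<xi>. a * (h \<xi> * g (override_on \<zeta> \<xi> A))
        + \<epsilon> * (\<Sum>x\<in>A. region_gen p A x h \<xi> * g (override_on \<zeta> \<xi> A)))"
      by (simp add: h'_def algebra_simps sum_distrib_left)
    also have "\<dots> = a * ?F h + \<epsilon> * (\<Sum>x\<in>A. ?F (region_gen p A x h))"
      by simp
    finally have 2: "?F h' = a * ?F h + \<epsilon> * (\<Sum>x\<in>A. ?F (region_gen p A x h))" .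
    show ?thesis
      unfolding 1 2 mean' by (simp add: sum.distrib sum_subtractf a_def k_def algebra_simps)
  qed
  moreover have "\<bar>x + \<epsilon> * y\<bar> \<le> r + \<epsilon> * s" if "\<bar>x\<bar> \<le> r" "\<bar>y\<bar> \<le> s" for x y r s :: real
    using that \<epsilon>(1) by (intro order.trans[OF abs_triangle_ineq] add_mono) (auto simp: abs_mult mult_left_mono)
  ultimately have "\<bar>expectation (\<lambda>\<xi>. h \<xi> * euler p \<Lambda> \<epsilon> g (override_on \<zeta> \<xi> A)) - m * expectation h\<bar>
      \<le> R * (B * ?r) + \<epsilon> * (k * (R * B))"
    by presburger
  also have "\<dots> = R * (1 - \<epsilon> * l + \<epsilon>\<^sup>2 * (real (card \<Lambda>))\<^sup>2) * B"
    by (simp add: a_def algebra_simps)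
  finally show "\<bar>expectation (\<lambda>\<xi>. h \<xi> * euler p \<Lambda> \<epsilon> g (override_on \<zeta> \<xi> A)) - m * expectation h\<bar>
      \<le> R * (1 - \<epsilon> * l + \<epsilon>\<^sup>2 * (real (card \<Lambda>))\<^sup>2) * B" .
qed

end

section \<open>From finite clusters to decay for the discretised dynamics\<close>

lemma occ_connected_refl: "\<eta> x \<Longrightarrow> occ_connected \<eta> x x"
  unfolding occ_connected_def by (rule exI[of _ "[x]"]) (auto simp: tree_path_def)

lemma occ_connected_length: "occ_connected \<eta> x y \<Longrightarrow> length x \<le> length y"
proof -
  have "successively parent_of xs \<Longrightarrow> xs \<noteq> [] \<Longrightarrow> z \<in> set xs \<Longrightarrow> length z \<le> length (last xs)" for z xs
    by (induction parent_of xs arbitrary: z rule: successively.induct) (force simp: parent_of_def)+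
  then show "occ_connected \<eta> x y \<Longrightarrow> length x \<le> length y"
    unfolding occ_connected_def tree_path_def by (metis hd_in_set)
qed

text \<open>Distinctness of the extended path: every vertex on the old path is connected to
  \<open>y\<close>, hence at most as deep as \<open>y\<close>, which excludes
  \<open>b # y\<close>.\<close>

lemma occ_connected_snoc:
  assumes "occ_connected \<eta> x y" "\<eta> (b # y)"
  shows "occ_connected \<eta> x (b # y)"
proof -
  obtain xs where xs: "tree_path xs" "hd xs = x" "last xs = y" "\<forall>z\<in>set xs. \<eta> z"
    using assms by (auto simp: occ_connected_def)
  have "occ_connected \<eta> z y" if "z \<in> set xs" for z
  proof -
    obtain us vs where "xs = us @ z # vs"
      using \<open>z \<in> set xs\<close> by (auto dest: split_list)
    then show ?thesis
      unfolding occ_connected_def using xs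
      by (intro exI[of _ "z # vs"]) (auto simp: tree_path_def successively_append_iff)
  qed
  then have "b # y \<notin> set xs"
    using occ_connected_length by fastforce
  then show ?thesis
    unfolding occ_connected_def using xs assms
    by (intro exI[of _ "xs @ [b # y]"]) (auto simp: tree_path_def successively_append_iff parent_of_def)
qed

lemma occ_connected_parent:
  assumes "occ_connected \<eta> x (b # y)"
  shows "x = b # y \<or> occ_connected \<eta> x y"
proof -
  obtain xs where xs: "tree_path xs" "hd xs = x" "last xs = b # y" "\<forall>z\<in>set xs. \<eta> z"
    using assms by (auto simp: occ_connected_def)
  define ys where "ys = butlast xs"
  have eq: "xs = ys @ [b # y]"
    using xs by (metis ys_def append_butlast_last_id tree_path_def)
  show ?thesis
  proof (cases "ys = []")
    case True
    then show ?thesis using xs eq by simp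
  next
    case False
    then have "last ys = y"
      using xs unfolding eq tree_path_def by (auto simp: successively_append_iff parent_of_def)
    then have "occ_connected \<eta> x y"
      using xs False unfolding occ_connected_def eq tree_path_def
      by (intro exI[of _ ys]) (auto simp: successively_append_iff)
    then show ?thesis ..
  qed
qed

lemma finite_region_exists:
  assumes "\<forall>x. finite (cluster \<eta> x)" "finite S"
  obtains A where "finite A" "S \<subseteq> A" "parent_closed A" "zero_boundary A \<eta>"
proof -
  obtain n where n: "S \<subseteq> levels n"
    using assms(2) by (rule finite_subset_levels)
  \<comment> \<open>Clusters starting at depth at most \<open>n + 1\<close> are added whole: an
    occupied child of a site in \<open>levels n\<close> starts one, an occupied child of a cluster
    site prolongs it. Going up, one stays in the cluster until its start, whose parent lies in
    \<open>levels n\<close>.\<close>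
  define A where "A = levels n \<union> (\<Union>x\<in>levels (Suc n). cluster \<eta> x)"
  show ?thesis
  proof
    show "finite A" "S \<subseteq> A"
      using assms n by (auto simp: A_def)
    show "parent_closed A"
      unfolding parent_closed_def A_def cluster_def levels_def
      by (fastforce dest: occ_connected_parent)
    show "zero_boundary A \<eta>"
      unfolding zero_boundary_def
    proof safe
      fix z b assume z: "z \<in> A" "b # z \<notin> A" "\<eta> (b # z)"
      show False
      proof (cases "z \<in> levels n")
        case True
        then show ?thesis
          using z occ_connected_refl[of \<eta> "b # z"] by (auto simp: A_def levels_def cluster_def)
      next
        case False
        then show ?thesis
          using z occ_connected_snoc[of \<eta> _ z b] by (auto simp: A_def cluster_def)
      qed
    qed
  qed
qed

section \<open>Decay of the Euler iterates started from a fixed configuration\<close>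

context bernoulli_tree
begin

lemma contracts_euler_funpow:
  fixes \<epsilon> :: real
  assumes "poincare l" "finite \<Lambda>" "local_fun f" "0 \<le> R" "contracts \<Lambda> S f m R"
    and \<epsilon>: "0 \<le> \<epsilon>" "\<epsilon> * card \<Lambda> \<le> 1 / 2" "\<epsilon> * l \<le> 1 / 4"
  shows "contracts \<Lambda> S ((euler p \<Lambda> \<epsilon> ^^ N) f) m (R * (1 - \<epsilon> * l + \<epsilon>\<^sup>2 * (real (card \<Lambda>))\<^sup>2) ^ N)"
proof (induction N)
  case (Suc N)
  have "0 \<le> 1 - \<epsilon> * l + \<epsilon>\<^sup>2 * (real (card \<Lambda>))\<^sup>2"
    using \<epsilon> by (intro add_nonneg_nonneg) auto
  then have "0 \<le> R * (1 - \<epsilon> * l + \<epsilon>\<^sup>2 * (real (card \<Lambda>))\<^sup>2) ^ N"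
    using assms(4) by simp
  from contracts_euler[OF assms(1,2) _ this Suc \<epsilon>] assms(3) show ?case
    by (simp add: mult_ac)
qed (use assms in simp)

text \<open>The density is the product over \<open>A\<close> of the indicators that the spin agrees
  with \<open>\<eta>\<close>, each divided by its probability, which is positive as
  \<open>0 < p < 1\<close>.\<close>

lemma point_mass_density:
  assumes "0 < p" "p < 1" "finite A"
  obtains h where "depends_on h A" "expectation h = 1"
    "\<And>g. local_fun g \<Longrightarrow> expectation (\<lambda>\<xi>. h \<xi> * g (override_on \<eta> \<xi> A)) = g \<eta>"
proof -
  have "\<exists>h. depends_on h A \<and> (\<forall>g. local_fun g \<longrightarrow> expectation (\<lambda>\<xi>. h \<xi> * g (override_on \<eta> \<xi> A)) = g \<eta>)"
    using assms(3)
  proof (induction A)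
    case empty
    show ?case
      by (rule exI[of _ "\<lambda>_. 1"]) (auto simp: depends_on_def)
  next
    case (insert y A)
    then obtain h where h: "depends_on h A"
      "\<And>g. local_fun g \<Longrightarrow> expectation (\<lambda>\<xi>. h \<xi> * g (override_on \<eta> \<xi> A)) = g \<eta>"
      by blast
    define k :: "bool \<Rightarrow> real" where "k b = of_bool (b = \<eta> y) / (if \<eta> y then p else 1 - p)" for b
    have kloc: "local_fun (\<lambda>\<xi>. k (\<xi> y))"
      unfolding local_fun_def by (rule exI[of _ "{y}"]) auto
    have hloc: "local_fun h"
      using h insert by (auto intro: depends_on_local_fun)
    have "expectation (\<lambda>\<xi>. h \<xi> * k (\<xi> y) * g (override_on \<eta> \<xi> (insert y A))) = g \<eta>" if g: "local_fun g" for g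
    proof -
      let ?G = "\<lambda>\<xi>. h \<xi> * k (\<xi> y) * g (override_on \<eta> \<xi> (insert y A))"
      have eq: "override_on \<eta> (\<xi>(y := \<eta> y)) (insert y A) = override_on \<eta> \<xi> A" for \<xi>
        using insert by (auto simp: override_on_def fun_eq_iff)
      \<comment> \<open>Averaging over \<open>y\<close> against \<open>k\<close> puts the spin
        \<open>\<eta> y\<close> there, which is the same as leaving \<open>y\<close> frozen.\<close>
      have "site_avg p y ?G \<xi> = h \<xi> * g (override_on \<eta> \<xi> A)" for \<xi>
        using assms eq[of \<xi>] depends_on_upd[OF h(1) insert.hyps(2)]
        by (cases "\<eta> y") (simp_all add: site_avg_eq k_def)
      then have "site_avg p y ?G = (\<lambda>\<xi>. h \<xi> * g (override_on \<eta> \<xi> A))" ..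
      moreover have "local_fun ?G"
        using g hloc kloc by (intro local_fun_arith local_fun_override_on)
      ultimately show ?thesis
        using expectation_site_avg[of ?G y] h(2)[OF g] by simp
    qed
    moreover have "depends_on (\<lambda>\<xi>. h \<xi> * k (\<xi> y)) (insert y A)"
    proof (rule depends_on_comb[where f = h and g = "\<lambda>\<xi>. k (\<xi> y)" and \<phi> = "(*)"])
      show "depends_on h (insert y A)"
        using h(1) by (rule depends_on_mono) auto
    qed (auto simp: depends_on_def)
    ultimately show ?case
      by blast
  qed
  then obtain h where h: "depends_on h A"
    "\<And>g. local_fun g \<Longrightarrow> expectation (\<lambda>\<xi>. h \<xi> * g (override_on \<eta> \<xi> A)) = g \<eta>"
    by blast
  from h(1) h(2)[of "\<lambda>_. 1"] h(2) show ?thesis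
    by (intro that) auto
qed

text \<open>\<open>A\<close> and \<open>C\<close> are chosen before \<open>\<Lambda>\<close>,
  \<open>\<epsilon>\<close> and \<open>N\<close>, so that the bound survives the limits. For
  \<open>\<epsilon> = t / N\<close> and fixed \<open>\<Lambda>\<close> the second-order terms
  accumulate to order \<open>1 / N\<close> only.\<close>

definition euler_decay :: "config \<Rightarrow> (config \<Rightarrow> real) \<Rightarrow> real \<Rightarrow> bool" where
  "euler_decay \<eta> f l \<longleftrightarrow> (\<exists>A C. finite A \<and> (\<forall>\<Lambda> \<epsilon> N. finite \<Lambda> \<longrightarrow> A \<subseteq> \<Lambda> \<longrightarrow> 0 \<le> \<epsilon> \<longrightarrow> \<epsilon> * real (card \<Lambda>) \<le> 1 / 2 \<longrightarrow> \<epsilon> * l \<le> 1 / 4 \<longrightarrow>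
     \<bar>(euler p \<Lambda> \<epsilon> ^^ N) f \<eta> - expectation f\<bar> \<le> C * (1 - \<epsilon> * l + \<epsilon>\<^sup>2 * (real (card \<Lambda>))\<^sup>2) ^ N))"

lemma euler_decay_of_poincare:
  assumes p: "0 < p" "p < 1" and l: "poincare l" and f: "local_fun f"
    and fin: "\<forall>x. finite (cluster \<eta> x)"
  shows "euler_decay \<eta> f l"
proof -
  obtain S where S: "finite S" "depends_on f S"
    using f by (auto simp: local_fun_iff)
  obtain A where A: "finite A" "S \<subseteq> A" "parent_closed A" "zero_boundary A \<eta>"
    using fin S(1) by (rule finite_region_exists)
  obtain D where D: "\<And>\<xi>. \<bar>f \<xi>\<bar> \<le> D"
    using local_fun_bounded[OF f] by metis
  obtain h where h: "depends_on h A" "expectation h = 1"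
    "\<And>g. local_fun g \<Longrightarrow> expectation (\<lambda>\<xi>. h \<xi> * g (override_on \<eta> \<xi> A)) = g \<eta>"
    using point_mass_density[OF p A(1), of \<eta>] by metis
  \<comment> \<open>A positive number whose square dominates the variance: adding \<open>1\<close>
    gives \<open>1 \<le> B\<close>, hence \<open>B \<le> B\<^sup>2\<close>.\<close>
  define B where "B = 1 + expectation (\<lambda>\<xi>. (h \<xi> - expectation h)\<^sup>2)"
  have B1: "1 \<le> B"
    by (simp add: B_def)
  then have "0 < B" and "B \<le> B\<^sup>2"
    using mult_left_mono[of 1 B B] by (auto simp: power2_eq_square)
  then have B: "0 < B" "expectation (\<lambda>\<xi>. (h \<xi> - expectation h)\<^sup>2) \<le> B\<^sup>2"
    by (auto simp: B_def)
  show ?thesis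
    unfolding euler_decay_def
  proof (intro exI conjI allI impI)
    show "finite A" by fact
    fix \<Lambda> :: "vertex set" and \<epsilon> :: real and N :: nat
    assume \<Lambda>: "finite \<Lambda>" "A \<subseteq> \<Lambda>" and \<epsilon>: "0 \<le> \<epsilon>" "\<epsilon> * real (card \<Lambda>) \<le> 1 / 2" "\<epsilon> * l \<le> 1 / 4"
    let ?g = "(euler p \<Lambda> \<epsilon> ^^ N) f" and ?r = "1 - \<epsilon> * l + \<epsilon>\<^sup>2 * (real (card \<Lambda>))\<^sup>2"
    have "contracts \<Lambda> S ?g (expectation f) ((1 + D\<^sup>2) / 2 * ?r ^ N)"
      using contracts_self[OF S \<Lambda>(1) D] l \<Lambda> f \<epsilon> by (intro contracts_euler_funpow) auto
    then have "\<bar>expectation (\<lambda>\<xi>. h \<xi> * ?g (override_on \<eta> \<xi> A)) - expectation f * expectation h\<bar> \<le> (1 + D\<^sup>2) / 2 * ?r ^ N * B"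
      by (rule contractsD[OF _ A(2) \<Lambda>(2) A(3,4) h(1) B])
    then show "\<bar>?g \<eta> - expectation f\<bar> \<le> ((1 + D\<^sup>2) / 2 * B) * ?r ^ N"
      using f by (simp add: h mult_ac)
  qed
qed

text \<open>For \<open>p = 0\<close> the point mass at \<open>\<eta>\<close> has no density with respect to \<open>\<mu>\<close>. But then occupied
  sites are only ever removed, and their total weight in the region decays, because a blocked occupied
  site can be charged to an occupied child of twice its weight.\<close>

lemma occupied_weight_le:
  assumes "finite A" "zero_boundary A \<zeta>"
  defines "w \<equiv> \<lambda>x :: vertex. 2 ^ length x * of_bool (\<zeta> x) :: real"
  shows "(\<Sum>x\<in>A. w x) \<le> 2 * (\<Sum>x\<in>A. AD_rate x \<zeta> * w x)"
proof -
  have w0: "0 \<le> w x" for x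
    by (simp add: w_def)
  let ?I = "{z \<in> A \<times> UNIV. snd z # fst z \<in> A}"
  have "2 * ((1 - AD_rate x \<zeta>) * w x) \<le> (\<Sum>b | b # x \<in> A. w (b # x))" if x: "x \<in> A" for x
  proof (cases "\<exists>b. \<zeta> (b # x)")
    case True
    then obtain b where b: "\<zeta> (b # x)" ..
    have "b # x \<in> A"
      using assms(2) b x by (auto simp: zero_boundary_def)
    then have "w (b # x) \<le> (\<Sum>b | b # x \<in> A. w (b # x))"
      by (intro member_le_sum) (auto simp: w0)
    moreover have "2 * ((1 - AD_rate x \<zeta>) * w x) \<le> w (b # x)"
      using b by (auto simp: w_def AD_rate_iff)
    ultimately show ?thesis by linarith
  next
    case False
    then show ?thesis
      by (simp add: AD_rate_iff sum_nonneg w0)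
  qed
  then have "(\<Sum>x\<in>A. 2 * ((1 - AD_rate x \<zeta>) * w x)) \<le> (\<Sum>x\<in>A. \<Sum>b | b # x \<in> A. w (b # x))"
    by (rule sum_mono)
  also have "\<dots> = (\<Sum>(x, b)\<in>(SIGMA x:A. {b. b # x \<in> A}). w (b # x))"
    using assms(1) by (intro sum.Sigma) auto
  \<comment> \<open>A vertex has only one parent, so no weight is counted twice.\<close>
  also have "\<dots> = (\<Sum>y\<in>(\<lambda>(x, b). b # x) ` (SIGMA x:A. {b. b # x \<in> A}). w y)"
    by (subst sum.reindex) (auto simp: inj_on_def case_prod_unfold)
  also have "\<dots> \<le> (\<Sum>y\<in>A. w y)"
    using assms(1) w0 by (intro sum_mono2) auto
  finally have "(\<Sum>x\<in>A. 2 * ((1 - AD_rate x \<zeta>) * w x)) \<le> (\<Sum>x\<in>A. w x)" .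
  moreover have "(\<Sum>x\<in>A. 2 * ((1 - AD_rate x \<zeta>) * w x)) = 2 * (\<Sum>x\<in>A. w x) - 2 * (\<Sum>x\<in>A. AD_rate x \<zeta> * w x)"
    unfolding sum_distrib_left sum_subtractf[symmetric] by (simp add: algebra_simps)
  ultimately show ?thesis
    by linarith
qed

text \<open>For \<open>p = 0\<close> the average over a site empties it, so the sites of the support
  can be emptied one by one without changing the expectation.\<close>

lemma expectation_p0:
  assumes "p = 0" "local_fun f"
  shows "expectation f = f (\<lambda>_. False)"
proof -
  obtain S where S: "finite S" "depends_on f S"
    using assms by (auto simp: local_fun_iff)
  have "expectation (\<lambda>\<xi>. f (override_on \<xi> (\<lambda>_. False) A)) = expectation f" if "finite A" for A
    using that
  proof (induction A)
    case (insert y A)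
    let ?g = "\<lambda>\<xi>. f (override_on \<xi> (\<lambda>_. False) A)"
    have "local_fun ?g"
      using assms(2)
    proof (rule local_fun_compose)
      fix x
      show "\<exists>T. finite T \<and> (\<forall>\<xi> \<xi>'. (\<forall>y\<in>T. \<xi> y = \<xi>' y) \<longrightarrow> override_on \<xi> (\<lambda>_. False) A x = override_on \<xi>' (\<lambda>_. False) A x)"
        by (rule exI[of _ "{x}"]) (simp add: override_on_def)
    qed
    then have "expectation (site_avg p y ?g) = expectation f"
      using expectation_site_avg insert by simp
    moreover have "site_avg p y ?g = (\<lambda>\<xi>. f (override_on \<xi> (\<lambda>_. False) (insert y A)))"
      unfolding site_avg_eq[abs_def] by (simp add: assms(1) override_on_insert')
    ultimately show ?case by simp
  qed simp
  from this[OF S(1)] have "expectation f = expectation (\<lambda>\<xi>. f (override_on \<xi> (\<lambda>_. False) S))" ..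
  also have "(\<lambda>\<xi>. f (override_on \<xi> (\<lambda>_. False) S)) = (\<lambda>\<xi>. f (\<lambda>_. False))"
    by (rule ext, rule depends_onD[OF S(2)]) (auto simp: override_on_def)
  finally show ?thesis by simp
qed

text \<open>The weight \<open>?V\<close> is a Lyapunov function: it is at least \<open>1\<close>
  unless \<open>A\<close> is empty of particles, where \<open>f\<close> takes its limit value; an
  allowed update in \<open>A\<close> removes the weight of its site; and the sites allowed to update
  carry at least half of the weight, whence the rate \<open>1 / 2\<close>.\<close>

lemma euler_decay_p0:
  assumes p: "p = 0" and f: "local_fun f" and fin: "\<forall>x. finite (cluster \<eta> x)"
  shows "euler_decay \<eta> f (1 / 2)"
proof -
  obtain S where S: "finite S" "depends_on f S"
    using f by (auto simp: local_fun_iff)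
  obtain A where A: "finite A" "S \<subseteq> A" "parent_closed A" "zero_boundary A \<eta>"
    using fin S(1) by (rule finite_region_exists)
  obtain D where D: "D \<ge> 0" "\<And>\<xi>. \<bar>f \<xi>\<bar> \<le> D"
    using local_fun_bounded[OF f] by metis
  let ?w = "\<lambda>\<zeta> x. 2 ^ length x * of_bool (\<zeta> x) :: real"
  let ?V = "\<lambda>\<zeta> :: config. \<Sum>x\<in>A. ?w \<zeta> x" and ?f0 = "f (\<lambda>_. False)"
  have V0: "0 \<le> ?V \<zeta>" for \<zeta>
    by (simp add: sum_nonneg)
  have decay: "\<bar>(euler p \<Lambda> \<epsilon> ^^ N) f \<zeta> - ?f0\<bar> \<le> 2 * D * (1 - \<epsilon> / 2) ^ N * ?V \<zeta>"
    if \<Lambda>: "finite \<Lambda>" "A \<subseteq> \<Lambda>" and \<epsilon>: "0 \<le> \<epsilon>" "\<epsilon> * real (card \<Lambda>) \<le> 1 / 2" "\<epsilon> \<le> 1 / 2"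
      and zb: "zero_boundary A \<zeta>" for \<Lambda> :: "vertex set" and \<epsilon> N \<zeta>
    using zb
  proof (induction N arbitrary: \<zeta>)
    case 0
    show ?case
    proof (cases "\<exists>x\<in>A. \<zeta> x")
      case True
      then obtain x where x: "x \<in> A" "\<zeta> x" by blast
      have "1 \<le> ?w \<zeta> x"
        using x by simp
      also have "\<dots> \<le> ?V \<zeta>"
        using A x by (intro member_le_sum) auto
      finally have "2 * D * 1 \<le> 2 * D * ?V \<zeta>"
        using D by (intro mult_left_mono) auto
      then show ?thesis
        using D(2)[of \<zeta>] D(2)[of "\<lambda>_. False"] by simp
    next
      case False
      have "f \<zeta> = ?f0"
        by (rule depends_onD[OF S(2)]) (use False A in auto)
      then show ?thesis
        using V0 D by simp
    qed
  next
    case (Suc N)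
    define g where "g = (euler p \<Lambda> \<epsilon> ^^ N) f"
    define K where "K = 2 * D * (1 - \<epsilon> / 2) ^ N"
    have K: "0 \<le> K"
      using D \<epsilon> by (simp add: K_def)
    define c where "c = (\<Sum>x\<in>\<Lambda>. AD_rate x \<zeta>)"
    have c: "c \<le> real (card \<Lambda>)"
      unfolding c_def using AD_rate_range[of _ \<zeta>] sum_bounded_above[of \<Lambda> "\<lambda>x. AD_rate x \<zeta>" 1]
      by (auto simp: AD_rate_def)
    have "\<epsilon> * c \<le> 1"
      using mult_left_mono[OF c \<epsilon>(1)] \<epsilon>(2) by linarith
    have rate0: "0 \<le> AD_rate x \<zeta>" for x
      by (simp add: AD_rate_def)
    have V_upd: "?V (\<zeta>(x := False)) = ?V \<zeta> - (if x \<in> A then ?w \<zeta> x else 0)" for x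
    proof -
      have "?V (\<zeta>(x := False)) = (\<Sum>y\<in>A. ?w \<zeta> y - (if y = x then ?w \<zeta> y else 0))"
        by (intro sum.cong) auto
      then show ?thesis
        using A by (simp add: sum_subtractf)
    qed
    have g_upd: "\<bar>g (\<zeta>(x := False)) - ?f0\<bar> \<le> K * (?V \<zeta> - (if x \<in> A then ?w \<zeta> x else 0))" for x
    proof -
      \<comment> \<open>Updates only empty sites, so the boundary stays empty and \<open>A\<close>
        never has to change.\<close>
      have "zero_boundary A (\<zeta>(x := False))"
        using Suc.prems by (auto simp: zero_boundary_def)
      from Suc.IH[OF this] show ?thesis
        unfolding V_upd g_def K_def .
    qed
    have g_here: "\<bar>g \<zeta> - ?f0\<bar> \<le> K * ?V \<zeta>"
      using Suc by (simp add: g_def K_def)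
    have "(euler p \<Lambda> \<epsilon> ^^ Suc N) f \<zeta> - ?f0
        = (1 - \<epsilon> * c) * (g \<zeta> - ?f0) + \<epsilon> * (\<Sum>x\<in>\<Lambda>. AD_rate x \<zeta> * (g (\<zeta>(x := False)) - ?f0))"
    proof -
      have "site_avg p x g \<zeta> = g (\<zeta>(x := False))" for x
        unfolding site_avg_eq by (simp add: p)
      then have "euler p \<Lambda> \<epsilon> g \<zeta> - ?f0
          = (1 - \<epsilon> * c) * (g \<zeta> - ?f0) + \<epsilon> * (\<Sum>x\<in>\<Lambda>. AD_rate x \<zeta> * (g (\<zeta>(x := False)) - ?f0))"
        by (simp add: euler_def site_gen_def c_def algebra_simps sum_subtractf sum_distrib_left sum.distrib)
      then show ?thesis
        by (simp add: g_def)
    qed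
    then have "\<bar>(euler p \<Lambda> \<epsilon> ^^ Suc N) f \<zeta> - ?f0\<bar>
        = \<bar>(1 - \<epsilon> * c) * (g \<zeta> - ?f0) + \<epsilon> * (\<Sum>x\<in>\<Lambda>. AD_rate x \<zeta> * (g (\<zeta>(x := False)) - ?f0))\<bar>"
      by (rule arg_cong)
    also have "\<dots> \<le> (1 - \<epsilon> * c) * \<bar>g \<zeta> - ?f0\<bar> + \<epsilon> * (\<Sum>x\<in>\<Lambda>. AD_rate x \<zeta> * \<bar>g (\<zeta>(x := False)) - ?f0\<bar>)"
    proof (intro order.trans[OF abs_triangle_ineq] add_mono)
      show "\<bar>(1 - \<epsilon> * c) * (g \<zeta> - ?f0)\<bar> \<le> (1 - \<epsilon> * c) * \<bar>g \<zeta> - ?f0\<bar>"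
        using \<open>\<epsilon> * c \<le> 1\<close> by (simp add: abs_mult)
      have "\<bar>\<Sum>x\<in>\<Lambda>. AD_rate x \<zeta> * (g (\<zeta>(x := False)) - ?f0)\<bar> \<le> (\<Sum>x\<in>\<Lambda>. AD_rate x \<zeta> * \<bar>g (\<zeta>(x := False)) - ?f0\<bar>)"
        using rate0 by (intro order.trans[OF sum_abs]) (simp add: abs_mult)
      then show "\<bar>\<epsilon> * (\<Sum>x\<in>\<Lambda>. AD_rate x \<zeta> * (g (\<zeta>(x := False)) - ?f0))\<bar> \<le> \<epsilon> * (\<Sum>x\<in>\<Lambda>. AD_rate x \<zeta> * \<bar>g (\<zeta>(x := False)) - ?f0\<bar>)"
        using \<epsilon> by (simp add: abs_mult mult_left_mono)
    qed
    also have "\<dots> \<le> (1 - \<epsilon> * c) * (K * ?V \<zeta>)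
        + \<epsilon> * (\<Sum>x\<in>\<Lambda>. AD_rate x \<zeta> * (K * (?V \<zeta> - (if x \<in> A then ?w \<zeta> x else 0))))"
      using \<open>\<epsilon> * c \<le> 1\<close> \<epsilon> rate0 g_upd g_here by (intro add_mono mult_left_mono sum_mono) auto
    also have "(\<Sum>x\<in>\<Lambda>. AD_rate x \<zeta> * (K * (?V \<zeta> - (if x \<in> A then ?w \<zeta> x else 0))))
        = K * ?V \<zeta> * c - K * (\<Sum>x\<in>\<Lambda>. if x \<in> A then AD_rate x \<zeta> * ?w \<zeta> x else 0)"
      unfolding c_def sum_distrib_left sum_subtractf[symmetric]
      by (intro sum.cong) (auto simp: algebra_simps sum_distrib_left)
    also have "(\<Sum>x\<in>\<Lambda>. if x \<in> A then AD_rate x \<zeta> * ?w \<zeta> x else 0) = (\<Sum>x\<in>A. AD_rate x \<zeta> * ?w \<zeta> x)"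
      using \<Lambda> by (simp add: sum.If_cases Int_absorb1)
    also have "(1 - \<epsilon> * c) * (K * ?V \<zeta>) + \<epsilon> * (K * ?V \<zeta> * c - K * (\<Sum>x\<in>A. AD_rate x \<zeta> * ?w \<zeta> x))
        = K * (?V \<zeta> - \<epsilon> * (\<Sum>x\<in>A. AD_rate x \<zeta> * ?w \<zeta> x))"
      by (simp only: algebra_simps)
    also have "\<dots> \<le> K * (?V \<zeta> - \<epsilon> * (?V \<zeta> / 2))"
      using K \<epsilon> occupied_weight_le[OF A(1) Suc.prems]
      by (intro mult_left_mono diff_left_mono) auto
    also have "\<dots> = 2 * D * (1 - \<epsilon> / 2) ^ Suc N * ?V \<zeta>"
      by (simp add: K_def algebra_simps)
    finally show ?case .
  qed
  show ?thesis
    unfolding euler_decay_def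
  proof (intro exI conjI allI impI)
    show "finite A" by fact
    fix \<Lambda> :: "vertex set" and \<epsilon> :: real and N :: nat
    assume \<Lambda>: "finite \<Lambda>" "A \<subseteq> \<Lambda>" and \<epsilon>: "0 \<le> \<epsilon>" "\<epsilon> * real (card \<Lambda>) \<le> 1 / 2" "\<epsilon> * (1 / 2) \<le> 1 / 4"
    have "\<bar>(euler p \<Lambda> \<epsilon> ^^ N) f \<eta> - ?f0\<bar> \<le> 2 * D * (1 - \<epsilon> / 2) ^ N * ?V \<eta>"
      using \<Lambda> \<epsilon> A by (intro decay) auto
    \<comment> \<open>The nonnegative second-order term is inserted to match the form of
      \<open>euler_decay\<close>.\<close>
    also have "\<dots> \<le> 2 * D * (1 - \<epsilon> * (1 / 2) + \<epsilon>\<^sup>2 * (real (card \<Lambda>))\<^sup>2) ^ N * ?V \<eta>"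
      using V0 D \<epsilon> by (intro mult_right_mono mult_left_mono power_mono) auto
    finally show "\<bar>(euler p \<Lambda> \<epsilon> ^^ N) f \<eta> - expectation f\<bar>
        \<le> (2 * D * ?V \<eta>) * (1 - \<epsilon> * (1 / 2) + \<epsilon>\<^sup>2 * (real (card \<Lambda>))\<^sup>2) ^ N"
      by (simp add: expectation_p0[OF p f] mult_ac)
  qed
qed

end

section \<open>Decay of influence\<close>

context bernoulli_tree
begin

text \<open>The base \<open>4\<close> beats the \<open>2 ^ n\<close> sites of level
  \<open>n\<close>, whose total influence is at most \<open>C / 2 ^ n\<close>. In return, a
  constraint passing influence from a site on to its children costs a factor
  \<open>4\<close>.\<close>

definition osc_decay :: "(config \<Rightarrow> real) \<Rightarrow> real \<Rightarrow> bool" where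
  "osc_decay g C \<longleftrightarrow> (\<forall>\<xi> x b. \<bar>g (\<xi>(x := b)) - g \<xi>\<bar> \<le> C / 4 ^ length x)"

lemma osc_decayD: "osc_decay g C \<Longrightarrow> \<bar>g (\<xi>(x := b)) - g \<xi>\<bar> \<le> C / 4 ^ length x"
  by (simp add: osc_decay_def)

lemma osc_decay_nonneg: "osc_decay g C \<Longrightarrow> 0 \<le> C"
  using osc_decayD[of g C _ "[]"] by force

lemma osc_decay_mono: "osc_decay g C \<Longrightarrow> C \<le> D \<Longrightarrow> osc_decay g D"
  unfolding osc_decay_def by (meson divide_right_mono order.trans zero_le_numeral zero_le_power)

lemma local_fun_osc_decay:
  assumes "local_fun f"
  obtains C where "osc_decay f C"
proof -
  obtain S where S: "finite S" "depends_on f S"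
    using assms by (auto simp: local_fun_iff)
  obtain k where k: "S \<subseteq> levels k"
    using S(1) by (rule finite_subset_levels)
  obtain D where D: "0 \<le> D" "\<And>\<xi>. \<bar>f \<xi>\<bar> \<le> D"
    using local_fun_bounded[OF assms] by metis
  have "\<bar>f (\<xi>(x := b)) - f \<xi>\<bar> \<le> 2 * D * 4 ^ k / 4 ^ length x" for \<xi> x b
  proof (cases "x \<in> S")
    case True
    then have "(4 :: real) ^ length x \<le> 4 ^ k"
      using k by (intro power_increasing) (auto simp: levels_def)
    then have "2 * D * 1 \<le> 2 * D * (4 ^ k / 4 ^ length x)"
      using D by (intro mult_left_mono) auto
    then show ?thesis
      using D(2)[of \<xi>] D(2)[of "\<xi>(x := b)"] by simp
  next
    case False
    then show ?thesis
      using D by (simp add: depends_on_upd[OF S(2)])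
  qed
  then show ?thesis
    by (intro that[of "2 * D * 4 ^ k"]) (auto simp: osc_decay_def)
qed

lemma site_avg_const [simp]: "site_avg p x (\<lambda>_. c) \<xi> = c"
  by (simp add: site_avg_eq algebra_simps)

lemma site_avg_diff_self_le:
  assumes "osc_decay g C"
  shows "\<bar>site_avg p y g \<xi> - g \<xi>\<bar> \<le> C / 4 ^ length y"
  using site_avg_diff_le[of g \<xi> y "\<lambda>_. g \<xi>" \<xi> "C / 4 ^ length y"] osc_decayD[OF assms] by simp

lemma abs_site_gen_le:
  assumes "osc_decay g C"
  shows "\<bar>site_gen p y g \<xi>\<bar> \<le> C / 4 ^ length y"
  using site_avg_diff_self_le[OF assms, of y \<xi>] AD_rate_range[of y \<xi>] osc_decay_nonneg[OF assms]
  by (auto simp: site_gen_def)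

text \<open>The spin at \<open>x\<close> enters through \<open>g\<close>, and through the constraint
  at \<open>y\<close> if \<open>x\<close> is a child of \<open>y\<close>. If the constraint changes,
  one of the two generator terms is 0 and the other is at most \<open>C / 4 ^ length y\<close>, four
  times the bound at \<open>x\<close>.\<close>

lemma osc_site_update:
  assumes "osc_decay g C"
  shows "\<bar>(g (\<xi>(x := b)) + site_gen p y g (\<xi>(x := b))) - (g \<xi> + site_gen p y g \<xi>)\<bar>
    \<le> C / 4 ^ length x + (if \<exists>c. x = c # y then 4 * (C / 4 ^ length x) else 0)"
proof -
  let ?\<xi>' = "\<xi>(x := b)"
  have here: "\<bar>g ?\<xi>' - g \<xi>\<bar> \<le> C / 4 ^ length x"
    by (rule osc_decayD[OF assms])
  have C0: "0 \<le> C / 4 ^ length x"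
    using osc_decay_nonneg[OF assms] by simp
  have avg: "\<bar>site_avg p y g ?\<xi>' - site_avg p y g \<xi>\<bar> \<le> C / 4 ^ length x"
  proof (rule site_avg_diff_le)
    fix c
    show "\<bar>g (?\<xi>'(y := c)) - g (\<xi>(y := c))\<bar> \<le> C / 4 ^ length x"
      using osc_decayD[OF assms, of "\<xi>(y := c)" x b] C0
      by (cases "x = y") (simp_all add: fun_upd_twist)
  qed
  show ?thesis
  proof (cases "AD_rate y ?\<xi>' = AD_rate y \<xi>")
    case True
    then show ?thesis
      using here avg C0 AD_rate_range[of y \<xi>] by (auto simp: site_gen_def)
  next
    case False
    then have child: "\<exists>c. x = c # y"
      by (auto simp: AD_rate_iff split: if_splits)
    then have "C / 4 ^ length y = 4 * (C / 4 ^ length x)"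
      by auto
    then have "\<bar>site_gen p y g ?\<xi>'\<bar> \<le> 4 * (C / 4 ^ length x)" "\<bar>site_gen p y g \<xi>\<bar> \<le> 4 * (C / 4 ^ length x)"
      using abs_site_gen_le[OF assms, of y] by metis+
    moreover have "site_gen p y g ?\<xi>' = 0 \<or> site_gen p y g \<xi> = 0"
      using False AD_rate_range[of y ?\<xi>'] AD_rate_range[of y \<xi>] by (auto simp: site_gen_def)
    ultimately show ?thesis
      using here child by auto
  qed
qed

text \<open>For \<open>0 \<le> \<epsilon>\<close> and
  \<open>\<epsilon> * card \<Lambda> \<le> 1\<close> this is a convex combination of
  \<open>g\<close> and single-site updates, so bounds stable under one update carry over.\<close>

lemma euler_eq:
  "euler p \<Lambda> \<epsilon> g \<xi> = (1 - \<epsilon> * real (card \<Lambda>)) * g \<xi> + \<epsilon> * (\<Sum>y\<in>\<Lambda>. g \<xi> + site_gen p y g \<xi>)"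
  by (simp add: euler_def sum.distrib algebra_simps)

lemma euler_bound:
  assumes "0 \<le> \<epsilon>" "\<epsilon> * real (card \<Lambda>) \<le> 1" "\<And>\<xi>. \<bar>g \<xi>\<bar> \<le> D"
  shows "\<bar>euler p \<Lambda> \<epsilon> g \<xi>\<bar> \<le> D"
proof -
  have "\<bar>g \<xi> + site_gen p y g \<xi>\<bar> \<le> D" for y
    using AD_rate_range[of y \<xi>] assms(3) site_avg_diff_le[of g \<xi> y "\<lambda>_. 0" \<xi> D] by (auto simp: site_gen_def)
  then have "\<bar>\<Sum>y\<in>\<Lambda>. g \<xi> + site_gen p y g \<xi>\<bar> \<le> real (card \<Lambda>) * D"
    by (intro order.trans[OF sum_abs] sum_bounded_above)
  then have "\<bar>\<epsilon> * (\<Sum>y\<in>\<Lambda>. g \<xi> + site_gen p y g \<xi>)\<bar> \<le> \<epsilon> * (real (card \<Lambda>) * D)"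
    using assms(1) by (simp add: abs_mult mult_left_mono)
  moreover have "\<bar>(1 - \<epsilon> * real (card \<Lambda>)) * g \<xi>\<bar> \<le> (1 - \<epsilon> * real (card \<Lambda>)) * D"
    using assms(2,3) by (simp add: abs_mult mult_left_mono)
  ultimately have "\<bar>euler p \<Lambda> \<epsilon> g \<xi>\<bar> \<le> (1 - \<epsilon> * real (card \<Lambda>)) * D + \<epsilon> * (real (card \<Lambda>) * D)"
    unfolding euler_eq by linarith
  then show ?thesis
    by (simp add: algebra_simps)
qed

lemma osc_decay_euler:
  assumes g: "osc_decay g C" and \<epsilon>: "0 \<le> \<epsilon>" "\<epsilon> * real (card \<Lambda>) \<le> 1" and \<Lambda>: "finite \<Lambda>"
  shows "osc_decay (euler p \<Lambda> \<epsilon> g) (C * (1 + 4 * \<epsilon>))"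
  unfolding osc_decay_def
proof (intro allI)
  fix \<xi> :: config and x b
  let ?d = "C / 4 ^ length x" and ?\<xi>' = "\<xi>(x := b)"
  have d: "0 \<le> ?d"
    using osc_decay_nonneg[OF g] by simp
  let ?T = "\<lambda>y \<xi>. g \<xi> + site_gen p y g \<xi>"
  have "\<bar>\<Sum>y\<in>\<Lambda>. ?T y ?\<xi>' - ?T y \<xi>\<bar> \<le> (\<Sum>y\<in>\<Lambda>. ?d + (if \<exists>c. x = c # y then 4 * ?d else 0))"
    by (intro order.trans[OF sum_abs] sum_mono osc_site_update g)
  also have "\<dots> = real (card \<Lambda>) * ?d + (\<Sum>y\<in>\<Lambda>. if \<exists>c. x = c # y then 4 * ?d else 0)"
    by (simp add: sum.distrib)
  \<comment> \<open>Only the parent of \<open>x\<close> has \<open>x\<close> as a child, so at most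
    one term is nonzero.\<close>
  also have "(\<Sum>y\<in>\<Lambda>. if \<exists>c. x = c # y then 4 * ?d else 0) \<le> 4 * ?d"
    using \<Lambda> d by (cases x) auto
  finally have "\<epsilon> * \<bar>\<Sum>y\<in>\<Lambda>. ?T y ?\<xi>' - ?T y \<xi>\<bar> \<le> \<epsilon> * (real (card \<Lambda>) * ?d + 4 * ?d)"
    using \<epsilon> by (simp add: mult_left_mono)
  then have "\<bar>\<epsilon> * (\<Sum>y\<in>\<Lambda>. ?T y ?\<xi>' - ?T y \<xi>)\<bar> \<le> \<epsilon> * (real (card \<Lambda>) * ?d + 4 * ?d)"
    using \<epsilon> by (simp add: abs_mult)
  moreover have "\<bar>(1 - \<epsilon> * real (card \<Lambda>)) * (g ?\<xi>' - g \<xi>)\<bar> \<le> (1 - \<epsilon> * real (card \<Lambda>)) * ?d"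
    unfolding abs_mult using \<epsilon> by (intro mult_mono osc_decayD[OF g]) auto
  moreover have "euler p \<Lambda> \<epsilon> g ?\<xi>' - euler p \<Lambda> \<epsilon> g \<xi>
      = (1 - \<epsilon> * real (card \<Lambda>)) * (g ?\<xi>' - g \<xi>) + \<epsilon> * (\<Sum>y\<in>\<Lambda>. ?T y ?\<xi>' - ?T y \<xi>)"
    unfolding euler_eq sum_subtractf by (simp only: algebra_simps)
  ultimately have "\<bar>euler p \<Lambda> \<epsilon> g ?\<xi>' - euler p \<Lambda> \<epsilon> g \<xi>\<bar>
      \<le> (1 - \<epsilon> * real (card \<Lambda>)) * ?d + \<epsilon> * (real (card \<Lambda>) * ?d + 4 * ?d)"
    by linarith
  also have "\<dots> = C * (1 + 4 * \<epsilon>) / 4 ^ length x"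
    by (simp add: field_simps)
  finally show "\<bar>euler p \<Lambda> \<epsilon> g ?\<xi>' - euler p \<Lambda> \<epsilon> g \<xi>\<bar> \<le> C * (1 + 4 * \<epsilon>) / 4 ^ length x" .
qed

text \<open>The deepest updated sites have depth \<open>n\<close>, and their constraints read depth
  \<open>n + 1\<close> but nothing below. So all iterates live on one fixed finite set.\<close>

lemma depends_on_euler_levels:
  assumes "depends_on g (levels (Suc n))"
  shows "depends_on (euler p (levels n) \<epsilon> g) (levels (Suc n))"
  unfolding depends_on_def
proof (intro allI impI)
  fix \<xi> \<xi>' :: config assume eq: "\<forall>x\<in>levels (Suc n). \<xi> x = \<xi>' x"
  have "g \<xi> = g \<xi>'"
    by (rule depends_onD[OF assms]) (use eq in auto)
  moreover have "g (\<xi>(x := b)) = g (\<xi>'(x := b))" for x b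
    by (rule depends_onD[OF assms]) (use eq in auto)
  moreover have "AD_rate x \<xi> = AD_rate x \<xi>'" if "x \<in> levels n" for x
    using eq that by (simp add: AD_rate_iff levels_def)
  ultimately show "euler p (levels n) \<epsilon> g \<xi> = euler p (levels n) \<epsilon> g \<xi>'"
    by (simp add: euler_def site_gen_def site_avg_eq)
qed

text \<open>The truncation omits exactly the updates at depth \<open>n + 1\<close>: there are
  \<open>2 ^ Suc n\<close> such sites, each contributing at most
  \<open>C / 4 ^ Suc n\<close>.\<close>

lemma AD_gen_euler_levels:
  assumes "osc_decay g C" "depends_on g (levels (Suc n))" "0 \<le> \<epsilon>"
  shows "\<bar>g \<xi> + \<epsilon> * AD_gen p g \<xi> - euler p (levels n) \<epsilon> g \<xi>\<bar> \<le> \<epsilon> * (C / 2 ^ Suc n)"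
proof -
  let ?L = "{x :: vertex. length x = Suc n}"
  have split: "levels (Suc n) = levels n \<union> ?L" "levels n \<inter> ?L = {}"
    by (auto simp: levels_def)
  have "finite ?L"
    using split(1) finite_levels[of "Suc n"] by (metis finite_Un)
  then have eq: "g \<xi> + \<epsilon> * AD_gen p g \<xi> - euler p (levels n) \<epsilon> g \<xi> = \<epsilon> * (\<Sum>x\<in>?L. site_gen p x g \<xi>)"
    using split by (simp add: AD_gen_eq_sum[OF finite_levels assms(2)] euler_def sum.union_disjoint algebra_simps)
  have "\<bar>\<Sum>x\<in>?L. site_gen p x g \<xi>\<bar> \<le> (\<Sum>x\<in>?L. C / 4 ^ Suc n)"
    using abs_site_gen_le[OF assms(1)] by (intro order.trans[OF sum_abs] sum_mono) (metis mem_Collect_eq)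
  also have "\<dots> = C / 2 ^ Suc n"
    using power_mult_distrib[of "2 :: real" 2 "Suc n"] by (simp only: sum_constant card_level) (simp add: field_simps)
  finally show ?thesis
    unfolding eq abs_mult abs_of_nonneg[OF assms(3)] by (rule mult_left_mono[OF _ assms(3)])
qed

end

section \<open>Comparison with the semigroup\<close>

lemma markov_semigroupD:
  assumes "markov_semigroup P" "0 \<le> t"
  shows "continuous_on UNIV f \<Longrightarrow> continuous_on UNIV (P t f)"
    and "continuous_on UNIV f \<Longrightarrow> continuous_on UNIV g \<Longrightarrow> P t (\<lambda>\<xi>. a * f \<xi> + b * g \<xi>) = (\<lambda>\<xi>. a * P t f \<xi> + b * P t g \<xi>)"
    and "continuous_on UNIV f \<Longrightarrow> P 0 f = f"
    and "continuous_on UNIV f \<Longrightarrow> 0 \<le> s \<Longrightarrow> P (s + t) f = P s (P t f)"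
    and "P t (\<lambda>_. 1) = (\<lambda>_. 1)"
    and "continuous_on UNIV f \<Longrightarrow> (\<And>\<xi>. 0 \<le> f \<xi>) \<Longrightarrow> 0 \<le> P t f \<xi>"
  using assms by (simp_all add: markov_semigroup_def)

text \<open>Positivity and preservation of constants, applied to \<open>c + f\<close> and
  \<open>c - f\<close>.\<close>

lemma markov_semigroup_contraction:
  assumes P: "markov_semigroup P" "0 \<le> t" and f: "continuous_on UNIV f" "\<And>\<xi>. \<bar>f \<xi>\<bar> \<le> c"
  shows "\<bar>P t f \<xi>\<bar> \<le> c"
proof -
  have "0 \<le> P t (\<lambda>\<xi>. c * 1 + s * f \<xi>) \<xi>" if "s = 1 \<or> s = -1" for s
  proof (rule markov_semigroupD(6)[OF P])
    show "continuous_on UNIV (\<lambda>\<xi>. c * 1 + s * f \<xi>)"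
      using f by (intro continuous_intros)
    show "0 \<le> c * 1 + s * f \<xi>" for \<xi>
      using f(2)[of \<xi>] that by auto
  qed
  moreover have "P t (\<lambda>\<xi>. c * 1 + s * f \<xi>) = (\<lambda>\<xi>. c * 1 + s * P t f \<xi>)" for s
    using markov_semigroupD(2)[OF P, of "\<lambda>_. 1" f c s] f markov_semigroupD(5)[OF P] by simp
  ultimately have "0 \<le> c * 1 + s * P t f \<xi>" if "s = 1 \<or> s = -1" for s
    using that by simp
  from this[of 1] this[of "-1"] show ?thesis
    by auto
qed

lemma markov_semigroup_sum:
  assumes P: "markov_semigroup P" "0 \<le> t" and f: "\<And>i. i \<in> I \<Longrightarrow> continuous_on UNIV (f i)"
  shows "P t (\<lambda>\<xi>. \<Sum>i\<in>I. a i * f i \<xi>) = (\<lambda>\<xi>. \<Sum>i\<in>I. a i * P t (f i) \<xi>)"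
proof -
  have zero: "P t (\<lambda>_. 0) = (\<lambda>_. 0)"
    using markov_semigroupD(2)[OF P, of "\<lambda>_. 1" "\<lambda>_. 1" 0 0] by simp
  show ?thesis
    using f
  proof (induction I rule: infinite_finite_induct)
    case (insert i I)
    have "P t (\<lambda>\<xi>. a i * f i \<xi> + 1 * (\<Sum>i\<in>I. a i * f i \<xi>))
        = (\<lambda>\<xi>. a i * P t (f i) \<xi> + 1 * P t (\<lambda>\<xi>. \<Sum>i\<in>I. a i * f i \<xi>) \<xi>)"
      using insert by (intro markov_semigroupD(2)[OF P] continuous_intros) auto
    then show ?case
      using insert by simp
  qed (simp_all add: zero)
qed

context bernoulli_tree
begin

text \<open>Uniformity over all functions of the finitely many sites in \<open>T\<close> is needed since the Euler
  iterates to which this is applied depend on \<open>\<epsilon>\<close>.\<close>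

lemma generator_uniform:
  assumes P: "AD_semigroup p P" and T: "finite T" and \<kappa>: "0 < \<kappa>"
  shows "\<forall>\<^sub>F \<epsilon> in at_right 0. \<forall>g B. depends_on g T \<longrightarrow> (\<forall>\<xi>. \<bar>g \<xi>\<bar> \<le> B) \<longrightarrow>
    (\<forall>\<xi>. \<bar>P \<epsilon> g \<xi> - g \<xi> - \<epsilon> * AD_gen p g \<xi>\<bar> \<le> \<epsilon> * (\<kappa> * B))"
proof -
  have M: "markov_semigroup P"
    using P by (simp add: AD_semigroup_def)
  \<comment> \<open>Each of the \<open>?n\<close> cylinder functions is allowed an error
    \<open>\<kappa> / ?n\<close>. The coefficients of \<open>g\<close> are values of
    \<open>g\<close>, hence at most \<open>B\<close>, and linearity sums the errors to
    \<open>\<kappa> * B\<close>.\<close>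
  let ?c = "\<lambda>\<sigma>. cylinder T \<sigma>" and ?n = "real (card (Pow T))"
  have n: "0 < ?n"
    using T by (auto simp: card_gt_0_iff)
  have "\<forall>\<^sub>F \<epsilon> in at_right 0. \<forall>\<sigma>\<in>Pow T. \<forall>\<xi>. dist ((P \<epsilon> (?c \<sigma>) \<xi> - ?c \<sigma> \<xi>) / \<epsilon>) (AD_gen p (?c \<sigma>) \<xi>) < \<kappa> / ?n"
  proof (rule eventually_ball_finite)
    show "\<forall>\<sigma>\<in>Pow T. \<forall>\<^sub>F \<epsilon> in at_right 0. \<forall>\<xi>. dist ((P \<epsilon> (?c \<sigma>) \<xi> - ?c \<sigma> \<xi>) / \<epsilon>) (AD_gen p (?c \<sigma>) \<xi>) < \<kappa> / ?n"
    proof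
      fix \<sigma>
      have "uniform_limit UNIV (\<lambda>t \<xi>. (P t (?c \<sigma>) \<xi> - ?c \<sigma> \<xi>) / t) (AD_gen p (?c \<sigma>)) (at_right 0)"
        using P T by (auto simp: AD_semigroup_def)
      then show "\<forall>\<^sub>F \<epsilon> in at_right 0. \<forall>\<xi>. dist ((P \<epsilon> (?c \<sigma>) \<xi> - ?c \<sigma> \<xi>) / \<epsilon>) (AD_gen p (?c \<sigma>) \<xi>) < \<kappa> / ?n"
        using \<kappa> n by (auto dest!: uniform_limitD[where e = "\<kappa> / ?n"])
    qed
  qed (use T in auto)
  moreover have "\<forall>\<^sub>F \<epsilon>::real in at_right 0. 0 < \<epsilon>"
    by (rule eventually_at_right_less)
  ultimately show ?thesis
  proof eventually_elim
    case (elim \<epsilon>)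
    have step: "\<bar>P \<epsilon> (?c \<sigma>) \<xi> - ?c \<sigma> \<xi> - \<epsilon> * AD_gen p (?c \<sigma>) \<xi>\<bar> \<le> \<epsilon> * (\<kappa> / ?n)" if "\<sigma> \<in> Pow T" for \<sigma> \<xi>
    proof -
      have eq: "P \<epsilon> (?c \<sigma>) \<xi> - ?c \<sigma> \<xi> - \<epsilon> * AD_gen p (?c \<sigma>) \<xi>
          = \<epsilon> * ((P \<epsilon> (?c \<sigma>) \<xi> - ?c \<sigma> \<xi>) / \<epsilon> - AD_gen p (?c \<sigma>) \<xi>)"
        using elim(2) by (simp add: field_simps)
      have "\<bar>(P \<epsilon> (?c \<sigma>) \<xi> - ?c \<sigma> \<xi>) / \<epsilon> - AD_gen p (?c \<sigma>) \<xi>\<bar> \<le> \<kappa> / ?n"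
        using less_imp_le[OF elim(1)[rule_format, OF that, of \<xi>]] by (simp add: dist_real_def)
      then show ?thesis
        unfolding eq abs_mult using elim(2) by (intro mult_mono) auto
    qed
    show ?case
    proof (intro allI impI)
      fix g B \<xi> assume g: "depends_on g T" and B: "\<forall>\<xi>. \<bar>g \<xi>\<bar> \<le> B"
      define a where "a \<sigma> = g (\<lambda>x. x \<in> \<sigma>)" for \<sigma>
      have g_eq: "g = (\<lambda>\<xi>. \<Sum>\<sigma>\<in>Pow T. a \<sigma> * ?c \<sigma> \<xi>)"
        unfolding a_def by (rule depends_on_expand[OF T g])
      have "P \<epsilon> g = (\<lambda>\<xi>. \<Sum>\<sigma>\<in>Pow T. a \<sigma> * P \<epsilon> (?c \<sigma>) \<xi>)"
        unfolding g_eq using elim(2) T by (intro markov_semigroup_sum[OF M]) auto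
      moreover have "AD_gen p g \<xi> = (\<Sum>\<sigma>\<in>Pow T. a \<sigma> * AD_gen p (?c \<sigma>) \<xi>)"
      proof -
        have "site_gen p x g \<xi> = (\<Sum>\<sigma>\<in>Pow T. a \<sigma> * site_gen p x (?c \<sigma>) \<xi>)" for x
          unfolding g_eq site_gen_def site_avg_eq
          by (simp add: sum_distrib_left sum.distrib sum_subtractf algebra_simps)
        moreover have "depends_on (?c \<sigma>) T" for \<sigma>
          by (auto simp: depends_on_def cylinder_def)
        ultimately show ?thesis
          using sum.swap[of "\<lambda>x \<sigma>. a \<sigma> * site_gen p x (?c \<sigma>) \<xi>" "Pow T" T]
          by (simp add: AD_gen_eq_sum[OF T] g sum_distrib_left)
      qed
      moreover have "g \<xi> = (\<Sum>\<sigma>\<in>Pow T. a \<sigma> * ?c \<sigma> \<xi>)"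
        using g_eq by (rule fun_cong)
      ultimately have "P \<epsilon> g \<xi> - g \<xi> - \<epsilon> * AD_gen p g \<xi>
          = (\<Sum>\<sigma>\<in>Pow T. a \<sigma> * (P \<epsilon> (?c \<sigma>) \<xi> - ?c \<sigma> \<xi> - \<epsilon> * AD_gen p (?c \<sigma>) \<xi>))"
        by (simp add: right_diff_distrib sum_subtractf sum_distrib_left mult.left_commute)
      also have "\<bar>\<dots>\<bar> \<le> (\<Sum>\<sigma>\<in>Pow T. B * (\<epsilon> * (\<kappa> / ?n)))"
      proof (intro order.trans[OF sum_abs] sum_mono)
        fix \<sigma> assume "\<sigma> \<in> Pow T"
        then show "\<bar>a \<sigma> * (P \<epsilon> (?c \<sigma>) \<xi> - ?c \<sigma> \<xi> - \<epsilon> * AD_gen p (?c \<sigma>) \<xi>)\<bar> \<le> B * (\<epsilon> * (\<kappa> / ?n))"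
          unfolding abs_mult using step B order.trans[OF abs_ge_zero B[rule_format]]
          by (intro mult_mono) (auto simp: a_def)
      qed
      also have "\<dots> = \<epsilon> * (\<kappa> * B)"
        using n by simp
      finally show "\<bar>P \<epsilon> g \<xi> - g \<xi> - \<epsilon> * AD_gen p g \<xi>\<bar> \<le> \<epsilon> * (\<kappa> * B)" .
    qed
  qed
qed

text \<open>The factors \<open>P \<epsilon>\<close> are replaced by \<open>G\<close> one at a time.
  Each replacement costs \<open>e\<close>, which the remaining semigroup, a contraction, does not
  amplify. The innermost factor goes first, so the induction generalises over
  \<open>j\<close>.\<close>

lemma telescope:
  assumes M: "markov_semigroup P" and \<epsilon>: "0 \<le> \<epsilon>" and f: "\<And>j. local_fun ((G ^^ j) f)"
    and step: "\<And>j \<xi>. j < N \<Longrightarrow> \<bar>P \<epsilon> ((G ^^ j) f) \<xi> - (G ^^ Suc j) f \<xi>\<bar> \<le> e"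
  shows "i + j \<le> N \<Longrightarrow> \<bar>P (real i * \<epsilon>) ((G ^^ j) f) \<xi> - (G ^^ (i + j)) f \<xi>\<bar> \<le> real i * e"
proof (induction i arbitrary: j)
  case 0
  then show ?case
    using markov_semigroupD(3)[OF M order.refl] f by (simp add: local_fun_continuous)
next
  case (Suc i)
  let ?g = "\<lambda>j. (G ^^ j) f"
  have cont: "continuous_on UNIV (?g j)" "continuous_on UNIV (P \<epsilon> (?g j))" for j
    using f markov_semigroupD(1)[OF M \<epsilon>] by (auto simp: local_fun_continuous)
  have i: "0 \<le> real i * \<epsilon>"
    using \<epsilon> by simp
  have "P (real (Suc i) * \<epsilon>) (?g j) = P (real i * \<epsilon>) (P \<epsilon> (?g j))"
    using markov_semigroupD(4)[OF M \<epsilon> cont(1) i] by (simp add: algebra_simps)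
  moreover have "\<bar>P (real i * \<epsilon>) (\<lambda>\<xi>. 1 * P \<epsilon> (?g j) \<xi> + (- 1) * ?g (Suc j) \<xi>) \<xi>\<bar> \<le> e"
    using step[of j] Suc.prems cont
    by (intro markov_semigroup_contraction[OF M i] continuous_intros) (auto simp del: funpow.simps)
  moreover have "P (real i * \<epsilon>) (\<lambda>\<xi>. 1 * P \<epsilon> (?g j) \<xi> + (- 1) * ?g (Suc j) \<xi>)
      = (\<lambda>\<xi>. 1 * P (real i * \<epsilon>) (P \<epsilon> (?g j)) \<xi> + (- 1) * P (real i * \<epsilon>) (?g (Suc j)) \<xi>)"
    by (rule markov_semigroupD(2)[OF M i cont(2,1)])
  moreover have "\<bar>P (real i * \<epsilon>) (?g (Suc j)) \<xi> - ?g (i + Suc j) \<xi>\<bar> \<le> real i * e"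
    using Suc by (intro Suc.IH) auto
  ultimately have "\<bar>P (real (Suc i) * \<epsilon>) (?g j) \<xi> - ?g (i + Suc j) \<xi>\<bar> \<le> e + real i * e"
    by (auto simp del: funpow.simps)
  then show ?case
    by (simp add: algebra_simps del: funpow.simps)
qed

text \<open>Two errors accumulate over time \<open>t\<close>: \<open>\<kappa> * D\<close> from the
  first-order expansion of the semigroup, and the truncation error, whose constant is multiplied by
  \<open>(1 + 4 * \<epsilon>) ^ j\<close>, at most \<open>exp (4 * t)\<close>.\<close>

lemma semigroup_euler_levels:
  assumes P: "AD_semigroup p P" and t: "0 < t" and \<kappa>: "0 < \<kappa>"
    and f: "depends_on f (levels n)" "osc_decay f C" "\<And>\<xi>. \<bar>f \<xi>\<bar> \<le> D"
  shows "\<forall>\<^sub>F N in sequentially. \<bar>P t f \<xi> - (euler p (levels n) (t / real N) ^^ N) f \<xi>\<bar>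
     \<le> t * (\<kappa> * D + C * exp (4 * t) / 2 ^ Suc n)"
proof -
  have M: "markov_semigroup P"
    using P by (simp add: AD_semigroup_def)
  have lim: "filterlim (\<lambda>N. t / real N) (at_right 0) sequentially"
    using t by real_asymp
  have "\<forall>\<^sub>F N in sequentially. t / real N * real (card (levels n)) \<le> 1"
    using t by real_asymp
  moreover have "\<forall>\<^sub>F N in sequentially. 0 < N"
    by (rule eventually_gt_at_top)
  moreover note filterlim_iff[THEN iffD1, rule_format, OF lim generator_uniform[OF P finite_levels[of "Suc n"] \<kappa>]]
  ultimately show ?thesis
  proof eventually_elim
    case (elim N)
    define \<epsilon> where "\<epsilon> = t / real N"
    have \<epsilon>: "0 < \<epsilon>" "\<epsilon> * real (card (levels n)) \<le> 1" "real N * \<epsilon> = t"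
      using elim t by (auto simp: \<epsilon>_def)
    let ?G = "euler p (levels n) \<epsilon>"
    have f': "depends_on f (levels (Suc n))"
      using f(1) by (rule depends_on_mono) (auto simp: levels_def)
    then have loc: "local_fun f"
      by (rule depends_on_local_fun) simp
    have dep: "depends_on ((?G ^^ j) f) (levels (Suc n))" for j
      by (induction j) (auto simp: f' depends_on_euler_levels)
    have bound: "\<bar>(?G ^^ j) f \<xi>\<bar> \<le> D" for j \<xi>
      by (induction j arbitrary: \<xi>) (use \<epsilon> f in \<open>auto intro!: euler_bound\<close>)
    have osc: "osc_decay ((?G ^^ j) f) (C * (1 + 4 * \<epsilon>) ^ j)" for j
    proof (induction j)
      case (Suc j)
      from osc_decay_euler[OF this _ \<epsilon>(2) finite_levels] \<epsilon>(1) show ?case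
        by (simp add: mult_ac)
    qed (use f in simp)
    have osc': "osc_decay ((?G ^^ j) f) (C * exp (4 * t))" if "j < N" for j
    proof (rule osc_decay_mono[OF osc], rule mult_left_mono)
      have "(1 + 4 * \<epsilon>) ^ j \<le> exp (4 * \<epsilon>) ^ j"
        using \<epsilon> by (intro power_mono) (auto simp: exp_ge_add_one_self)
      also have "\<dots> = exp (4 * (real j * \<epsilon>))"
        by (simp add: exp_of_nat_mult[symmetric] algebra_simps)
      also have "\<dots> \<le> exp (4 * t)"
        using that \<epsilon> mult_right_mono[of "real j" "real N" \<epsilon>] by simp
      finally show "(1 + 4 * \<epsilon>) ^ j \<le> exp (4 * t)" .
    qed (rule osc_decay_nonneg[OF f(2)])
    have "\<bar>P \<epsilon> ((?G ^^ j) f) \<xi> - (?G ^^ Suc j) f \<xi>\<bar> \<le> \<epsilon> * (\<kappa> * D + C * exp (4 * t) / 2 ^ Suc n)" if "j < N" for j \<xi>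
    proof -
      let ?g = "(?G ^^ j) f"
      have "\<bar>P \<epsilon> ?g \<xi> - ?g \<xi> - \<epsilon> * AD_gen p ?g \<xi>\<bar> \<le> \<epsilon> * (\<kappa> * D)"
        using elim(3)[folded \<epsilon>_def] dep bound by blast
      moreover have "\<bar>?g \<xi> + \<epsilon> * AD_gen p ?g \<xi> - ?G ?g \<xi>\<bar> \<le> \<epsilon> * (C * exp (4 * t) / 2 ^ Suc n)"
        using \<epsilon> by (intro AD_gen_euler_levels osc' that dep) auto
      ultimately have "\<bar>P \<epsilon> ?g \<xi> - ?G ?g \<xi>\<bar> \<le> \<epsilon> * (\<kappa> * D) + \<epsilon> * (C * exp (4 * t) / 2 ^ Suc n)"
        by linarith
      then show ?thesis
        by (simp only: funpow.simps o_apply distrib_left)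
    qed
    from telescope[OF M _ _ this, where i = N and j = 0 and \<xi> = \<xi>] \<epsilon> loc
    have "\<bar>P t f \<xi> - (?G ^^ N) f \<xi>\<bar> \<le> real N * (\<epsilon> * (\<kappa> * D + C * exp (4 * t) / 2 ^ Suc n))"
      by simp
    also have "\<dots> = t * (\<kappa> * D + C * exp (4 * t) / 2 ^ Suc n)"
      unfolding \<epsilon>(3)[symmetric] by (simp only: mult.assoc)
    finally show ?case
      by (simp only: \<epsilon>_def)
  qed
qed

text \<open>First \<open>N\<close> tends to infinity at fixed \<open>n\<close>, removing the
  second-order terms, then \<open>n\<close>, removing the truncation error. The order matters
  because the second-order terms grow with \<open>card (levels n)\<close>.\<close>

lemma semigroup_decay:
  assumes P: "AD_semigroup p P" and f: "local_fun f" and decay: "euler_decay \<eta> f l"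
  shows "\<exists>C. \<forall>t>0. \<bar>P t f \<eta> - expectation f\<bar> \<le> C * exp (- l * t)"
proof -
  obtain A C0 where A: "finite A" and C0: "\<And>\<Lambda> \<epsilon> N. finite \<Lambda> \<Longrightarrow> A \<subseteq> \<Lambda> \<Longrightarrow> 0 \<le> \<epsilon> \<Longrightarrow> \<epsilon> * real (card \<Lambda>) \<le> 1 / 2 \<Longrightarrow> \<epsilon> * l \<le> 1 / 4 \<Longrightarrow>
     \<bar>(euler p \<Lambda> \<epsilon> ^^ N) f \<eta> - expectation f\<bar> \<le> C0 * (1 - \<epsilon> * l + \<epsilon>\<^sup>2 * (real (card \<Lambda>))\<^sup>2) ^ N"
    using decay unfolding euler_decay_def by blast
  define C where "C = max C0 0"
  obtain S where S: "finite S" "depends_on f S"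
    using f by (auto simp: local_fun_iff)
  obtain n0 where n0: "S \<union> A \<subseteq> levels n0"
    using S A finite_subset_levels[of "S \<union> A"] by auto
  obtain D where D: "0 \<le> D" "\<And>\<xi>. \<bar>f \<xi>\<bar> \<le> D"
    using local_fun_bounded[OF f] by metis
  obtain E where E: "osc_decay f E"
    using local_fun_osc_decay[OF f] by metis
  have "\<bar>P t f \<eta> - expectation f\<bar> \<le> C * exp (- l * t)" if t: "0 < t" for t
  proof -
    have level_bound: "\<bar>P t f \<eta> - expectation f\<bar> \<le> t * (1 / 2 ^ n * D + E * exp (4 * t) / 2 ^ Suc n) + C * exp (- l * t)"
      if n: "n \<ge> n0" for n
    proof (rule tendsto_lowerbound)
      let ?K = "real (card (levels n))" and ?e = "t * (1 / 2 ^ n * D + E * exp (4 * t) / 2 ^ Suc n)"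
      show "((\<lambda>N. ?e + C * exp (- l * t + t\<^sup>2 * ?K\<^sup>2 / real N)) \<longlongrightarrow> ?e + C * exp (- l * t)) sequentially"
      proof (intro tendsto_intros)
        have "((\<lambda>N. - l * t + t\<^sup>2 * ?K\<^sup>2 / real N) \<longlongrightarrow> - l * t + 0) sequentially"
          by (intro tendsto_add tendsto_const lim_const_over_n)
        then show "((\<lambda>N. - l * t + t\<^sup>2 * ?K\<^sup>2 / real N) \<longlongrightarrow> - l * t) sequentially"
          by simp
      qed
      have sub: "levels n0 \<subseteq> levels n"
        using n by (rule levels_mono)
      have "depends_on f (levels n)"
        using S(2) by (rule depends_on_mono) (use n0 sub in auto)
      \<comment> \<open>Tying \<open>\<kappa>\<close> to \<open>n\<close> lets the limit in
        \<open>n\<close> remove both errors at once.\<close>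
      note semigroup_euler_levels[OF P t _ this E D(2), of "1 / 2 ^ n" \<eta>]
      then have "\<forall>\<^sub>F N in sequentially. \<bar>P t f \<eta> - (euler p (levels n) (t / real N) ^^ N) f \<eta>\<bar> \<le> ?e"
        by simp
      moreover have "\<forall>\<^sub>F N in sequentially. t / real N * ?K \<le> 1 / 2"
        using t by real_asymp
      moreover have "\<forall>\<^sub>F N in sequentially. t / real N * l \<le> 1 / 4"
        using t by real_asymp
      moreover have "\<forall>\<^sub>F N in sequentially. 0 < N"
        by (rule eventually_gt_at_top)
      ultimately show "\<forall>\<^sub>F N in sequentially. \<bar>P t f \<eta> - expectation f\<bar> \<le> ?e + C * exp (- l * t + t\<^sup>2 * ?K\<^sup>2 / real N)"
      proof eventually_elim
        case (elim N)
        define \<epsilon> where "\<epsilon> = t / real N"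
        have \<epsilon>: "0 \<le> \<epsilon>" "\<epsilon> * ?K \<le> 1 / 2" "\<epsilon> * l \<le> 1 / 4"
          using elim t by (auto simp: \<epsilon>_def)
        let ?r = "1 - \<epsilon> * l + \<epsilon>\<^sup>2 * ?K\<^sup>2"
        have r: "0 \<le> ?r"
          using \<epsilon> by (intro add_nonneg_nonneg) auto
        have "\<bar>(euler p (levels n) \<epsilon> ^^ N) f \<eta> - expectation f\<bar> \<le> C0 * ?r ^ N"
          using n0 sub \<epsilon> by (intro C0) auto
        also have "\<dots> \<le> C * ?r ^ N"
          using r by (intro mult_right_mono) (auto simp: C_def)
        \<comment> \<open>By \<open>1 + y \<le> exp y\<close>; \<open>N\<close> steps of size
          \<open>t / N\<close> leave \<open>t\<^sup>2 * ?K\<^sup>2 / real N\<close>, which vanishes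
          as \<open>N\<close> grows.\<close>
        also have "?r ^ N \<le> exp (- \<epsilon> * l + \<epsilon>\<^sup>2 * ?K\<^sup>2) ^ N"
          using exp_ge_add_one_self[of "- \<epsilon> * l + \<epsilon>\<^sup>2 * ?K\<^sup>2"] by (intro power_mono[OF _ r]) linarith
        also have "exp (- \<epsilon> * l + \<epsilon>\<^sup>2 * ?K\<^sup>2) ^ N = exp (- l * t + t\<^sup>2 * ?K\<^sup>2 / real N)"
          using elim(4) by (simp add: exp_of_nat_mult[symmetric] \<epsilon>_def field_simps power2_eq_square)
        finally have "\<bar>(euler p (levels n) \<epsilon> ^^ N) f \<eta> - expectation f\<bar> \<le> C * exp (- l * t + t\<^sup>2 * ?K\<^sup>2 / real N)"
          by (simp add: C_def mult_left_mono)
        then show ?case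
          using elim(1) unfolding \<epsilon>_def by linarith
      qed
    qed simp
    have "(\<lambda>n. t * (1 / 2 ^ n * D + E * exp (4 * t) / 2 ^ Suc n) + C * exp (- l * t)) \<longlonglongrightarrow> t * (0 * D + 0) + C * exp (- l * t)"
    proof (intro tendsto_intros)
      show "(\<lambda>n. 1 / 2 ^ n :: real) \<longlonglongrightarrow> 0"
        by real_asymp
      show "(\<lambda>n. E * exp (4 * t) / 2 ^ Suc n) \<longlonglongrightarrow> 0"
        by real_asymp
    qed
    then have "\<bar>P t f \<eta> - expectation f\<bar> \<le> t * (0 * D + 0) + C * exp (- l * t)"
      by (rule LIMSEQ_le_const) (use level_bound in blast)
    then show ?thesis
      by simp
  qed
  then show ?thesis
    by blast
qed

end

section \<open>From the process to its semigroup, and the theorem\<close>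

lemma AD_process_expectation:
  assumes "AD_process p \<eta> M X"
  obtains P where "AD_semigroup p P" "\<And>f t. local_fun f \<Longrightarrow> 0 \<le> t \<Longrightarrow> (\<integral>w. f (X t w) \<partial>M) = P t f \<eta>"
proof -
  interpret prob_space M
    using assms by (simp add: AD_process_def)
  obtain P where P: "AD_semigroup p P"
    and cond: "\<forall>s\<ge>0. \<forall>t\<ge>0. \<forall>f. continuous_on UNIV f \<longrightarrow>
      (AE w in M. real_cond_exp M (history M X s) (\<lambda>w. f (X (s + t) w)) w = P t f (X s w))"
    using assms by (auto simp: AD_process_def)
  have meas: "\<And>t. 0 \<le> t \<Longrightarrow> X t \<in> M \<rightarrow>\<^sub>M config_space" and start: "AE w in M. X 0 w = \<eta>"
    using assms by (auto simp: AD_process_def)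
  have sub: "subalgebra M (history M X 0)"
  proof -
    have "(\<lambda>w. \<lambda>u\<in>{0..0}. X u w) \<in> M \<rightarrow>\<^sub>M PiM {0..0::real} (\<lambda>_. config_space)"
      by (intro measurable_restrict meas) auto
    then show ?thesis
      unfolding subalgebra_def history_def by (auto dest: sets_image_in_sets[OF refl])
  qed
  interpret H: finite_measure_subalgebra M "history M X 0"
    by unfold_locales (rule sub)
  show ?thesis
  proof
    show "AD_semigroup p P" by fact
    fix f and t :: real assume f: "local_fun f" and t: "0 \<le> t"
    obtain B where B: "\<And>\<xi>. \<bar>f \<xi>\<bar> \<le> B"
      using local_fun_bounded[OF f] by metis
    have "integrable M (\<lambda>w. f (X t w))"
      using B measurable_compose[OF meas[OF t] local_fun_measurable[OF f]]
      by (intro integrable_const_bound[of _ B]) auto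
    \<comment> \<open>The Markov property at time \<open>0\<close>, integrated: conditioning
      preserves the integral, and \<open>X 0\<close> is almost surely \<open>\<eta>\<close>.\<close>
    then have "(\<integral>w. f (X t w) \<partial>M) = (\<integral>w. real_cond_exp M (history M X 0) (\<lambda>w. f (X t w)) w \<partial>M)"
      by (rule H.real_cond_exp_int(2)[symmetric])
    also have "\<dots> = (\<integral>w. P t f \<eta> \<partial>M)"
    proof (rule integral_cong_AE)
      show "AE w in M. real_cond_exp M (history M X 0) (\<lambda>w. f (X t w)) w = P t f \<eta>"
        using cond[rule_format, OF order.refl t local_fun_continuous[OF f]] start by eventually_elim simp
    qed auto
    finally show "(\<integral>w. f (X t w) \<partial>M) = P t f \<eta>"
      by (simp add: prob_space)
  qed
qed

theorem theorem4p2: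
  fixes p :: real and \<eta> :: config
    and M :: "'w measure" and X :: "real \<Rightarrow> 'w \<Rightarrow> config"
  assumes "0 \<le> p" and "p < 1"
    and "AD_process p \<eta> M X"
    and "\<forall>x. finite (cluster \<eta> x)"
    and "AD_gap p > 0"
  shows "\<exists>m>0. \<forall>f. local_fun f \<longrightarrow>
           (\<exists>C. \<exists>t0\<ge>0. \<forall>t>t0.
              \<bar>(\<integral>w. f (X t w) \<partial>M) - AD_mean p f\<bar> \<le> C * exp (- m * t))"
proof -
  interpret bernoulli_tree p
    using assms by unfold_locales auto
  obtain P where P: "AD_semigroup p P"
    and exp: "\<And>f t. local_fun f \<Longrightarrow> 0 \<le> t \<Longrightarrow> (\<integral>w. f (X t w) \<partial>M) = P t f \<eta>"
    using assms(3) by (rule AD_process_expectation) blast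
  \<comment> \<open>The rate is fixed before \<open>f\<close>: \<open>1 / 2\<close> if
    \<open>p = 0\<close>, otherwise a rate strictly below the gap.\<close>
  obtain l where l: "0 < l" "\<And>f. local_fun f \<Longrightarrow> euler_decay \<eta> f l"
  proof (cases "p = 0")
    case True
    then show ?thesis
      using that[of "1 / 2"] euler_decay_p0 assms(4) by auto
  next
    case False
    then show ?thesis
      using that poincare_of_gap[OF assms(5)] euler_decay_of_poincare assms by (metis less_eq_real_def)
  qed
  show ?thesis
  proof (rule exI[of _ l], intro conjI allI impI)
    show "0 < l" by fact
    fix f assume f: "local_fun f"
    then obtain C where "\<And>t. 0 < t \<Longrightarrow> \<bar>P t f \<eta> - expectation f\<bar> \<le> C * exp (- l * t)"
      using semigroup_decay[OF P f l(2)] by blast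
    then have "\<forall>t>0. \<bar>(\<integral>w. f (X t w) \<partial>M) - AD_mean p f\<bar> \<le> C * exp (- l * t)"
      using exp[OF f] by (auto simp: AD_mean_def)
    \<comment> \<open>The prefactor carries the dependence on \<open>\<eta>\<close>, so the bound
      holds from time \<open>0\<close> on.\<close>
    then show "\<exists>C. \<exists>t0\<ge>0. \<forall>t>t0. \<bar>(\<integral>w. f (X t w) \<partial>M) - AD_mean p f\<bar> \<le> C * exp (- l * t)"
      by - (rule exI[of _ C], rule exI[of _ 0], simp)
  qed
qed

end
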